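(* Let $p\ge2$ be an integer. Every planar graph with girth at least $5p-4$ is $p$-path degenerate, and there exists a planar graph with girth $5p-5$ that is not $p$-path degenerate.
   Context: Graphs are finite and simple; the girth is the length of a shortest cycle ($+\infty$ for forests). A strict ear of a graph $G$ is a path of $G$ whose internal vertices all have degree $2$ in $G$ and whose two endpoints are distinct. For an integer $p\ge1$, a $p$-reduction of $G$ is the deletion of either an isolated vertex, or a vertex of degree $1$, or the internal vertices of a strict ear of $G$ of length at least $p$. A graph is $p$-path degenerate if it can be reduced to the empty graph by a sequence of $p$-reductions. *)

theory Defs
  imports "HOL-Analysis.Analysis"
begin

definition graph :: "'a set \<Rightarrow> 'a set set \<Rightarrow> bool" where
  "graph V E \<longleftrightarrow> finite V \<and> (\<forall>e\<in>E. e \<subseteq> V \<and> card e = 2)"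

definition degree :: "'a set set \<Rightarrow> 'a \<Rightarrow> nat" where
  "degree E v = card {e\<in>E. v \<in> e}"

definition is_cycle :: "'a set \<Rightarrow> 'a set set \<Rightarrow> 'a list \<Rightarrow> bool" where
  "is_cycle V E cs \<longleftrightarrow> set cs \<subseteq> V \<and> distinct cs \<and> length cs \<ge> 3 \<and>
     (\<forall>i < length cs. {cs ! i, cs ! ((i + 1) mod length cs)} \<in> E)"

text \<open>Girth: length of a shortest cycle, infinity for forests (Inf of the empty set).\<close>
definition girth :: "'a set \<Rightarrow> 'a set set \<Rightarrow> enat" where
  "girth V E = (INF cs\<in>{cs. is_cycle V E cs}. enat (length cs))"

text \<open>A path is a nonempty list of distinct vertices with consecutive ones adjacent;
  its length is the number of edges, i.e. length of the list minus one.\<close>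
definition is_path :: "'a set \<Rightarrow> 'a set set \<Rightarrow> 'a list \<Rightarrow> bool" where
  "is_path V E xs \<longleftrightarrow> xs \<noteq> [] \<and> set xs \<subseteq> V \<and> distinct xs \<and>
     (\<forall>i. Suc i < length xs \<longrightarrow> {xs ! i, xs ! Suc i} \<in> E)"

definition internal_vertices :: "'a list \<Rightarrow> 'a set" where
  "internal_vertices xs = set (butlast (tl xs))"

definition strict_ear :: "'a set \<Rightarrow> 'a set set \<Rightarrow> 'a list \<Rightarrow> bool" where
  "strict_ear V E xs \<longleftrightarrow> is_path V E xs \<and> hd xs \<noteq> last xs \<and>
     (\<forall>v\<in>internal_vertices xs. degree E v = 2)"

definition del_verts :: "'a set \<Rightarrow> 'a set set \<Rightarrow> 'a set \<Rightarrow> 'a set \<times> 'a set set" where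
  "del_verts V E S = (V - S, {e\<in>E. e \<inter> S = {}})"

definition p_reduction :: "nat \<Rightarrow> 'a set \<Rightarrow> 'a set set \<Rightarrow> 'a set \<Rightarrow> 'a set set \<Rightarrow> bool" where
  "p_reduction p V E V' E' \<longleftrightarrow>
     (\<exists>v\<in>V. (degree E v = 0 \<or> degree E v = 1) \<and> (V', E') = del_verts V E {v}) \<or>
     (\<exists>xs. strict_ear V E xs \<and> length xs - 1 \<ge> p \<and>
           (V', E') = del_verts V E (internal_vertices xs))"

inductive path_degenerate :: "nat \<Rightarrow> 'a set \<Rightarrow> 'a set set \<Rightarrow> bool" for p where
  empty: "path_degenerate p {} E"
| step: "p_reduction p V E V' E' \<Longrightarrow> path_degenerate p V' E' \<Longrightarrow> path_degenerate p V E"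

definition planar :: "'a set \<Rightarrow> 'a set set \<Rightarrow> bool" where
  "planar V E \<longleftrightarrow> (\<exists>(f :: 'a \<Rightarrow> complex) (\<gamma> :: 'a set \<Rightarrow> real \<Rightarrow> complex).
     inj_on f V \<and>
     (\<forall>e\<in>E. arc (\<gamma> e) \<and>
        (\<exists>u v. e = {u, v} \<and> pathstart (\<gamma> e) = f u \<and> pathfinish (\<gamma> e) = f v) \<and>
        path_image (\<gamma> e) \<inter> f ` V = f ` e) \<and>
     (\<forall>e\<in>E. \<forall>e'\<in>E. e \<noteq> e' \<longrightarrow> path_image (\<gamma> e) \<inter> path_image (\<gamma> e') \<subseteq> f ` (e \<inter> e')))"

end

theory Submission
  imports Defs
begin

text \<open>Suppressing a vertex of degree 2 replaces its two edges by a single one; giving the new edge the sum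
  of their weights preserves planarity, the weights of cycles and the weights of ears.  A graph
  without \<open>p\<close>-reductions has minimum degree 2 and ears of weight at most \<open>p - 1\<close>, so if its girth
  exceeds \<open>5 * (p - 1)\<close>, then no cycle of a suppressed graph has fewer than 6 edges.  But a planar graph of girth at
  least 6 has a vertex of degree at most 2, and suppression never stops.

  The degree bound comes from a count of faces.  A graph that cannot be split at a vertex arises from
  a cycle by adding ears.  By the Jordan curve theorem and Janiszewski's theorem each ear
  splits one face into two, and the new boundaries are again cycles.  Hence there are
  \<open>m - n + 2\<close> faces, bounded by cycles of total length \<open>2 * m\<close>.

  For the sharpness, every edge of the dodecahedron is subdivided into a path of length \<open>p - 1\<close>.\<close>

section \<open>Theta curves\<close>

text \<open>The theta argument needs every face to be bounded by a cycle, and this fails at cut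
  vertices. The edge bound is therefore proved by splitting graphs along at most one common vertex,
  and its constant is chosen to survive the splitting: for an unsplittable graph with at least three
  vertices, counting faces of length at least 6 gives 2m + 6 <= 3n, but this fails for a single
  vertex and for a single edge. The weaker 2m + 3 <= 3n holds for these too, and two copies of it
  add up to the bound for a union with at most one common vertex. For the degree bound any positive
  constant would do.

  Vertices are suppressed one at a time so that the graph stays simple: a new edge parallel to an
  old one would come from a triangle, whose weight is at most 2(p - 1), since two of its edges form
  one ear. With weights the hypotheses reproduce themselves, because a cycle or ear of the
  suppressed graph stems from one of equal weight before.

  The dodecahedron is the extremal case: it is cubic, so that no vertex can be suppressed, and five
  of its edges close up.\<close>

definition closed_curve :: "complex set \<Rightarrow> bool" where
  "closed_curve J \<longleftrightarrow> (\<exists>c. simple_path c \<and> pathfinish c = pathstart c \<and> path_image c = J)"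

text \<open>Boundedness is deliberately left out, so that the outer face is treated like any other
  and inside and outside need no case split.\<close>

definition side_of :: "complex set \<Rightarrow> complex set \<Rightarrow> bool" where
  "side_of J S \<longleftrightarrow> S \<noteq> {} \<and> open S \<and> connected S \<and> frontier S = J"

lemma closed_curve_sides:
  assumes "closed_curve J"
  shows "side_of J (inside J)" "side_of J (outside J)"
    "inside J \<inter> outside J = {}" "inside J \<union> outside J = - J"
  using assms Jordan_inside_outside unfolding closed_curve_def side_of_def by metis+

lemma closed_curve_join:
  assumes "arc c1" "arc c2" "pathstart c1 = a" "pathfinish c1 = b"
    "pathstart c2 = a" "pathfinish c2 = b" "path_image c1 \<inter> path_image c2 = {a,b}"
  shows "closed_curve (path_image c1 \<union> path_image c2)"
proof -
  have "simple_path (c1 +++ reversepath c2)"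
    using assms by (intro simple_path_join_loop) (auto simp: arc_reversepath)
  moreover have "path_image (c1 +++ reversepath c2) = path_image c1 \<union> path_image c2"
    using assms by (simp add: path_image_join)
  ultimately show ?thesis
    unfolding closed_curve_def using assms
    by (intro exI[of _ "c1 +++ reversepath c2"]) auto
qed

lemma side_of_disjoint: "side_of J S \<Longrightarrow> S \<inter> J = {}"
  unfolding side_of_def by (metis Int_commute frontier_disjoint_eq)

lemma connected_subset_open_part:
  assumes "connected X" "open A" "open B" "A \<inter> B = {}" "X \<subseteq> A \<union> B" "X \<inter> A \<noteq> {}"
  shows "X \<subseteq> A"
  using connectedD[OF assms(1-3)] assms(4-6) by blast

text \<open>Off its frontier \<open>J\<close> the plane is the disjoint union of the open sets
  \<open>S\<close> and \<open>- closure S\<close>, and a connected set cannot meet both.\<close>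

lemma side_of_absorbs:
  assumes "side_of J S" "connected X" "X \<inter> J = {}" "X \<inter> S \<noteq> {}"
  shows "X \<subseteq> S"
proof -
  have "X \<subseteq> S \<union> - closure S"
    using assms unfolding side_of_def closure_Un_frontier by auto
  then show ?thesis
    using assms connected_subset_open_part[of X S "- closure S"] closure_subset[of S]
    unfolding side_of_def by (auto simp: open_Compl)
qed

lemma side_of_unique:
  assumes "side_of J S" "side_of J T" "S \<inter> T \<noteq> {}"
  shows "S = T"
  using side_of_absorbs[of J S T] side_of_absorbs[of J T S] side_of_disjoint[of J] assms
  unfolding side_of_def by blast

text \<open>A side is nonempty and avoids \<open>J\<close>, so it meets the inside or the outside
  and then coincides with it by \<open>side_of_unique\<close>.\<close>

lemma other_side:
  assumes "closed_curve J" "side_of J S"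
  obtains T where "side_of J T" "S \<inter> T = {}" "S \<union> T = - J"
proof -
  have "S \<noteq> {}" using assms by (simp add: side_of_def)
  then have "S \<inter> inside J \<noteq> {} \<or> S \<inter> outside J \<noteq> {}"
    using closed_curve_sides[OF assms(1)] side_of_disjoint[OF assms(2)] by blast
  then have "S = inside J \<or> S = outside J"
    using closed_curve_sides[OF assms(1)] side_of_unique[OF assms(2)] by blast
  then show thesis
    using closed_curve_sides[OF assms(1)] that by (metis Int_commute Un_commute)
qed

text \<open>A point of \<open>J\<close> is a limit of \<open>T\<close>, since \<open>J\<close> is
  the frontier of \<open>T\<close>. Hence the open set \<open>R\<close> around \<open>x\<close>
  meets \<open>T\<close>, and \<open>T\<close> is absorbed.\<close>

lemma side_of_absorbs_side:
  assumes "side_of J T" "x \<in> J" "side_of K R" "x \<in> R" "T \<inter> K = {}"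
  shows "T \<subseteq> R"
proof -
  have "x \<in> closure T" using assms(1,2) by (auto simp: side_of_def closure_Un_frontier)
  then have "R \<inter> T \<noteq> {}"
    using assms(3,4) open_Int_closure_eq_empty[of R T] by (auto simp: side_of_def)
  then show ?thesis
    using side_of_absorbs[OF assms(3), of T] assms(1,5) by (auto simp: side_of_def)
qed

text \<open>The side \<open>T\<close> opposite to \<open>S\<close> and the interior of \<open>c2\<close> lie on a common side
  \<open>T1\<close> of \<open>c1 \<union> c\<close>, since \<open>T\<close> has \<open>c2\<close> on its frontier; \<open>S1\<close> is the other side.\<close>
lemma theta_half:
  assumes arcs: "arc c1" "arc c2" "arc c"
    and ends: "pathstart c1 = a" "pathfinish c1 = b" "pathstart c2 = a" "pathfinish c2 = b"
      "pathstart c = a" "pathfinish c = b"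
    and meet: "path_image c1 \<inter> path_image c2 = {a,b}" "path_image c1 \<inter> path_image c = {a,b}"
      "path_image c2 \<inter> path_image c = {a,b}"
    and S: "side_of (path_image c1 \<union> path_image c2) S" "path_image c - {a,b} \<subseteq> S"
    and T: "side_of (path_image c1 \<union> path_image c2) T" "S \<inter> T = {}"
      "S \<union> T = - (path_image c1 \<union> path_image c2)"
  obtains S1 T1 where "side_of (path_image c1 \<union> path_image c) S1"
    "side_of (path_image c1 \<union> path_image c) T1" "S1 \<inter> T1 = {}"
    "S1 \<union> T1 = - (path_image c1 \<union> path_image c)" "T \<subseteq> T1" "S1 \<subseteq> S"
    "S1 \<inter> path_image c2 = {}"
proof -
  let ?K = "path_image c1 \<union> path_image c" and ?X = "path_image c2 - {a,b}"
  have K: "closed_curve ?K"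
    using closed_curve_join[of c1 c a b] arcs ends meet by auto
  have X: "connected ?X" "?X \<noteq> {}"
    using connected_simple_path_endless[of c2] nonempty_simple_path_endless[of c2] arcs ends
    by (auto simp: arc_imp_simple_path)
  have XK: "?X \<inter> ?K = {}" using meet by blast
  have cS: "path_image c \<subseteq> S \<union> {a,b}" using S(2) by blast
  have abJ: "{a,b} \<subseteq> path_image c1" using meet(1) by blast
  have TK: "T \<inter> ?K = {}"
    using side_of_disjoint[OF T(1)] T(2) cS abJ by blast
  obtain x where x: "x \<in> ?X" using X by blast
  have "x \<in> inside ?K \<or> x \<in> outside ?K"
    using XK x closed_curve_sides(4)[OF K] by blast
  then obtain T1 where T1: "side_of ?K T1" "x \<in> T1"
    using closed_curve_sides(1,2)[OF K] by blast
  obtain S1 where S1: "side_of ?K S1" "T1 \<inter> S1 = {}" "T1 \<union> S1 = - ?K"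
    using other_side[OF K T1(1)] .
  have TT1: "T \<subseteq> T1"
    using side_of_absorbs_side[OF T(1) _ T1(1,2) TK] x by blast
  have XT1: "?X \<subseteq> T1"
    using side_of_absorbs[OF T1(1) X(1) XK] x T1(2) by blast
  have ab: "{a,b} \<subseteq> ?K" using meet by blast
  have S1c2: "S1 \<inter> path_image c2 = {}"
    using XT1 S1(2,3) ab by blast
  have "S1 \<subseteq> - (path_image c1 \<union> path_image c2)" using S1c2 S1(3) by blast
  then have "S1 \<subseteq> S" using TT1 S1(2) T(3) by blast
  then show thesis using that[OF S1(1) T1(1) _ _ TT1] S1 S1c2 by blast
qed

text \<open>The two new sides come from \<open>theta_half\<close>, used once as it stands and once
  with \<open>c1\<close> and \<open>c2\<close> exchanged. If they overlapped, each would absorb the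
  other and their frontiers would agree, which would make \<open>c1\<close> part of
  \<open>c2\<close> and \<open>c\<close>.\<close>

lemma theta_split:
  assumes arcs: "arc c1" "arc c2" "arc c"
    and ends: "pathstart c1 = a" "pathfinish c1 = b" "pathstart c2 = a" "pathfinish c2 = b"
      "pathstart c = a" "pathfinish c = b"
    and meet: "path_image c1 \<inter> path_image c2 = {a,b}" "path_image c1 \<inter> path_image c = {a,b}"
      "path_image c2 \<inter> path_image c = {a,b}"
    and S: "side_of (path_image c1 \<union> path_image c2) S" "path_image c - {a,b} \<subseteq> S"
  obtains S1 S2 where "side_of (path_image c1 \<union> path_image c) S1"
    "side_of (path_image c2 \<union> path_image c) S2" "S1 \<inter> S2 = {}" "S1 \<union> S2 = S - path_image c"
proof -
  let ?J = "path_image c1 \<union> path_image c2"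
    and ?K1 = "path_image c1 \<union> path_image c" and ?K2 = "path_image c2 \<union> path_image c"
  have J: "closed_curve ?J" using closed_curve_join[of c1 c2 a b] arcs ends meet by auto
  obtain T where T: "side_of ?J T" "S \<inter> T = {}" "S \<union> T = - ?J"
    using other_side[OF J S(1)] .
  obtain S1 T1 where 1: "side_of ?K1 S1" "side_of ?K1 T1" "S1 \<inter> T1 = {}" "S1 \<union> T1 = - ?K1"
    "T \<subseteq> T1" "S1 \<subseteq> S" "S1 \<inter> path_image c2 = {}"
    using theta_half[OF arcs ends meet S T] by blast
  have S': "side_of (path_image c2 \<union> path_image c1) S" using S(1) by (simp add: Un_commute)
  have T': "side_of (path_image c2 \<union> path_image c1) T"
    "S \<union> T = - (path_image c2 \<union> path_image c1)" using T by (simp_all add: Un_commute)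
  have meet': "path_image c2 \<inter> path_image c1 = {a,b}" using meet by blast
  obtain S2 T2 where 2: "side_of ?K2 S2" "side_of ?K2 T2" "S2 \<inter> T2 = {}" "S2 \<union> T2 = - ?K2"
    "T \<subseteq> T2" "S2 \<subseteq> S" "S2 \<inter> path_image c1 = {}"
    using theta_half[OF arcs(2,1,3) ends(3,4,1,2,5,6) meet' meet(3,2) S' S(2) T'(1) T(2) T'(2)]
    by blast
  have dis: "S1 \<inter> S2 = {}"
  proof (rule ccontr)
    assume ne: "S1 \<inter> S2 \<noteq> {}"
    have "S1 \<subseteq> S2"
      using side_of_absorbs[OF 2(1), of S1] 1 ne unfolding side_of_def[of _ S1] by blast
    moreover have "S2 \<subseteq> S1"
      using side_of_absorbs[OF 1(1), of S2] 2 ne unfolding side_of_def[of _ S2] by blast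
    ultimately have "?K1 = ?K2" using 1(1) 2(1) by (auto simp: side_of_def)
    then have "path_image c1 - {a,b} = {}" using meet by blast
    then show False
      using nonempty_simple_path_endless[of c1] arcs ends by (auto simp: arc_imp_simple_path)
  qed
  \<comment> \<open>A point \<open>x\<close> of \<open>S\<close> off \<open>c\<close>,
    \<open>S1\<close> and \<open>S2\<close> lies on the side of \<open>T\<close> for both new
    curves. These meet exactly in the connected set \<open>c\<close>, so Janiszewski's theorem joins
    \<open>x\<close> to a point of \<open>T\<close> by a connected set avoiding both, hence avoiding
    the old curve that separates \<open>S\<close> from \<open>T\<close>.\<close>
  have cov: "S - path_image c \<subseteq> S1 \<union> S2"
  proof
    fix x assume x: "x \<in> S - path_image c"
    show "x \<in> S1 \<union> S2"
    proof (rule ccontr)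
      assume nx: "x \<notin> S1 \<union> S2"
      have xJ: "x \<notin> ?J" using x T(3) by blast
      have xT: "x \<in> T1" "x \<in> T2" using nx x xJ 1(4) 2(4) by blast+
      obtain t where t: "t \<in> T" using T(1) by (auto simp: side_of_def)
      have "connected_component (- ?K1) x t"
        unfolding connected_component_def using xT t 1 by (auto simp: side_of_def intro!: exI[of _ T1])
      moreover have "connected_component (- ?K2) x t"
        unfolding connected_component_def using xT t 2 by (auto simp: side_of_def intro!: exI[of _ T2])
      moreover have "?K1 \<inter> ?K2 = path_image c" using meet by blast
      then have "connected (?K1 \<inter> ?K2)" using arcs by (simp add: connected_arc_image)
      moreover have "compact ?K1" "closed ?K2"
        using arcs by (auto simp: compact_arc_image closed_arc_image)
      ultimately have "connected_component (- (?K1 \<union> ?K2)) x t" using Janiszewski by blast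
      then obtain Z where Z: "connected Z" "Z \<subseteq> - (?K1 \<union> ?K2)" "x \<in> Z" "t \<in> Z"
        unfolding connected_component_def by blast
      have "Z \<subseteq> T" using side_of_absorbs[OF T(1) Z(1)] Z t by blast
      then show False using Z(3) x T(2) by blast
    qed
  qed
  have "S1 \<union> S2 \<subseteq> S - path_image c"
    using 1(4,6) 2(4,6) by blast
  then show thesis using that[OF 1(1) 2(1) dis] cov by blast
qed

text \<open>Used to see that the ends of an ear drawn inside a face lie on the boundary of that
  face.\<close>

lemma pathstart_in_closure_interior:
  assumes "arc c"
  shows "pathstart c \<in> closure (path_image c - {pathstart c, pathfinish c})"
    "pathfinish c \<in> closure (path_image c - {pathstart c, pathfinish c})"
proof -
  have "c ` closure {0<..<1} \<subseteq> closure (c ` {0<..<1})"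
    using assms by (intro image_closure_subset)
      (auto simp: arc_def path_def closure_subset)
  moreover have "pathstart c \<in> c ` {0..1}" "pathfinish c \<in> c ` {0..1}"
    by (auto simp: pathstart_def pathfinish_def)
  ultimately show "pathstart c \<in> closure (path_image c - {pathstart c, pathfinish c})"
    "pathfinish c \<in> closure (path_image c - {pathstart c, pathfinish c})"
    using assms by (auto simp: simple_path_endless arc_imp_simple_path)
qed

section \<open>Drawings of paths and cycles\<close>

text \<open>The edges form a list and not a set, so that lengths and weights are sums over it and
  splitting and reversal become equations. \<open>is_path_iff\<close> and
  \<open>is_cycle_iff\<close> replace the index conditions of the definitions.\<close>

fun path_edges :: "'a list \<Rightarrow> 'a set list" where
  "path_edges (x # y # zs) = {x, y} # path_edges (y # zs)"
| "path_edges _ = []"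

lemma path_edges_split: "path_edges (xs @ y # ys) = path_edges (xs @ [y]) @ path_edges (y # ys)"
  by (induction xs rule: path_edges.induct) auto

lemma length_path_edges: "length (path_edges xs) = length xs - 1"
  by (induction xs rule: path_edges.induct) auto

lemma path_edges_rev: "path_edges (rev xs) = rev (path_edges xs)"
proof (induction xs rule: path_edges.induct)
  case (1 x y zs)
  have "path_edges (rev (x # y # zs)) = path_edges (rev zs @ [y]) @ path_edges [y, x]"
    using path_edges_split[of "rev zs" y "[x]"] by simp
  then show ?case using 1 by (simp add: insert_commute)
qed auto

lemma path_edges_subset: "e \<in> set (path_edges xs) \<Longrightarrow> e \<subseteq> set xs"
  by (induction xs rule: path_edges.induct) auto

lemma Union_path_edges: "length xs \<ge> 2 \<Longrightarrow> \<Union>(set (path_edges xs)) = set xs"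
proof (induction xs rule: path_edges.induct)
  case (1 x y zs)
  then show ?case by (cases zs) auto
qed auto

lemma distinct_path_edges: "distinct xs \<Longrightarrow> distinct (path_edges xs)"
proof (induction xs rule: path_edges.induct)
  case (1 x y zs)
  then show ?case using path_edges_subset[of "{x,y}" "y # zs"] by auto
qed auto

lemma set_path_edges_nth: "set (path_edges xs) = {{xs ! i, xs ! Suc i} | i. Suc i < length xs}"
proof (induction xs rule: path_edges.induct)
  case (1 x y zs)
  have "{{(x # y # zs) ! i, (x # y # zs) ! Suc i} | i. Suc i < length (x # y # zs)}
     = insert {x, y} {{(y # zs) ! i, (y # zs) ! Suc i} | i. Suc i < length (y # zs)}" (is "?L = ?R")
  proof
    show "?L \<subseteq> ?R"
    proof
      fix e assume "e \<in> ?L"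
      then obtain i where "e = {(x # y # zs) ! i, (x # y # zs) ! Suc i}" "Suc i < length (x # y # zs)"
        by blast
      then show "e \<in> ?R" by (cases i) auto
    qed
    show "?R \<subseteq> ?L"
    proof
      fix e assume "e \<in> ?R"
      then consider "e = {x, y}"
        | i where "e = {(y # zs) ! i, (y # zs) ! Suc i}" "Suc i < length (y # zs)" by blast
      then show "e \<in> ?L"
      proof cases
        case 1 then show ?thesis by (intro CollectI exI[of _ 0]) auto
      next
        case 2 then show ?thesis by (intro CollectI exI[of _ "Suc i"]) auto
      qed
    qed
  qed
  then show ?case using 1 by simp
qed auto

definition cycle_edges :: "'a list \<Rightarrow> 'a set list" where
  "cycle_edges cs = path_edges (cs @ [hd cs])"

lemma length_cycle_edges: "length (cycle_edges cs) = length cs"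
  by (simp add: cycle_edges_def length_path_edges)

lemma cycle_edges_append:
  "cycle_edges (a # u @ b # v) = path_edges (a # u @ [b]) @ path_edges (b # v @ [a])"
  using path_edges_split[of "a # u" b "v @ [a]"] by (simp add: cycle_edges_def)

text \<open>The list of edges depends on the vertex at which the cycle starts, its multiset does
  not. This allows a cycle to be restarted at a convenient vertex.\<close>

lemma mset_cycle_edges_rotate: "mset (cycle_edges (u @ v)) = mset (cycle_edges (v @ u))"
proof (cases "u = [] \<or> v = []")
  case False
  then obtain a u' b v' where [simp]: "u = a # u'" "v = b # v'" by (meson neq_Nil_conv)
  show ?thesis using cycle_edges_append[of a u' b v'] cycle_edges_append[of b v' a u'] by simp
qed auto

lemma set_cycle_edges_nth:
  assumes "cs \<noteq> []"
  shows "set (cycle_edges cs) = {{cs ! i, cs ! ((i + 1) mod length cs)} | i. i < length cs}"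
proof -
  have "(cs @ [hd cs]) ! Suc i = cs ! ((i + 1) mod length cs)" if "i < length cs" for i
  proof (cases "Suc i = length cs")
    case True then show ?thesis using assms by (simp add: nth_append hd_conv_nth)
  next
    case False then show ?thesis using that by (simp add: nth_append)
  qed
  moreover have "(cs @ [hd cs]) ! i = cs ! i" if "i < length cs" for i
    using that by (simp add: nth_append)
  ultimately have "(\<lambda>i. {(cs @ [hd cs]) ! i, (cs @ [hd cs]) ! Suc i}) ` {..<length cs}
      = (\<lambda>i. {cs ! i, cs ! ((i + 1) mod length cs)}) ` {..<length cs}"
    by (intro image_cong) auto
  then show ?thesis
    unfolding cycle_edges_def set_path_edges_nth by (simp add: image_def Bex_def conj_commute)
qed

lemma is_cycle_iff:
  "is_cycle V E cs \<longleftrightarrow>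
     set cs \<subseteq> V \<and> distinct cs \<and> length cs \<ge> 3 \<and> set (cycle_edges cs) \<subseteq> E"
proof (cases "cs = []")
  case False
  then show ?thesis unfolding is_cycle_def set_cycle_edges_nth[OF False] by auto
qed (auto simp: is_cycle_def)

lemma is_path_iff:
  "is_path V E xs \<longleftrightarrow> xs \<noteq> [] \<and> set xs \<subseteq> V \<and> distinct xs \<and> set (path_edges xs) \<subseteq> E"
  unfolding is_path_def set_path_edges_nth by auto

lemma is_cycle_rotate:
  assumes "is_cycle V E (u @ v)" shows "is_cycle V E (v @ u)"
proof -
  have "set (cycle_edges (u @ v)) = set (cycle_edges (v @ u))"
    using mset_cycle_edges_rotate[of u v] by (metis set_mset_mset)
  then show ?thesis using assms unfolding is_cycle_iff by auto
qed

lemma is_cycle_mono: "is_cycle V E cs \<Longrightarrow> V \<subseteq> V' \<Longrightarrow> E \<subseteq> E' \<Longrightarrow> is_cycle V' E' cs"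
  by (auto simp: is_cycle_iff)

text \<open>Length 3 matters: for two vertices the same edge would be listed twice.\<close>

lemma distinct_cycle_edges:
  assumes "distinct cs" "length cs \<ge> 3"
  shows "distinct (cycle_edges cs)"
proof -
  obtain a b c ds where cs: "cs = a # b # c # ds"
    using assms(2) unfolding numeral_3_eq_3 Suc_le_length_iff by blast
  have "{a,b} \<notin> set (path_edges ((c # ds) @ [a]))" "{a,b} \<noteq> {b,c}"
    using assms(1) path_edges_subset[of "{a,b}" "(c # ds) @ [a]"] unfolding cs
    by (auto simp: doubleton_eq_iff)
  moreover have "distinct (path_edges (b # (c # ds) @ [a]))"
    using assms(1) unfolding cs by (intro distinct_path_edges) auto
  ultimately show ?thesis by (simp add: cs cycle_edges_def)
qed

lemma cycle_through_two:
  assumes "a \<in> set cs" "b \<in> set cs" "a \<noteq> b"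
  obtains u v where "mset (cycle_edges cs) = mset (cycle_edges (a # u @ b # v))"
    "mset cs = mset (a # u @ b # v)"
proof -
  obtain s t where st: "cs = s @ a # t" using assms(1) by (meson split_list)
  then have "b \<in> set (t @ s)" using assms by auto
  then obtain u v where uv: "t @ s = u @ b # v" by (meson split_list)
  have m: "mset (cycle_edges cs) = mset (cycle_edges (a # u @ b # v))"
    unfolding st using mset_cycle_edges_rotate[of s "a # t"] uv by simp
  have "mset cs = {#a#} + mset (t @ s)" by (simp add: st)
  then have "mset cs = mset (a # u @ b # v)" by (simp only: uv) simp
  then show thesis using that[OF m] by blast
qed

text \<open>An ear decomposition inside the edge set \<open>E\<close>; \<open>W\<close> and
  \<open>F\<close> are the vertices and edges built so far. The list \<open>r\<close> may be empty,
  the ear then being a chord; the last premise keeps such a chord from being an edge already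
  present.\<close>

inductive ear_built :: "'a set set \<Rightarrow> 'a set \<Rightarrow> 'a set set \<Rightarrow> bool" for E where
  cycle: "distinct cs \<Longrightarrow> length cs \<ge> 3 \<Longrightarrow> set (cycle_edges cs) \<subseteq> E \<Longrightarrow>
    ear_built E (set cs) (set (cycle_edges cs))"
| ear: "ear_built E W F \<Longrightarrow> a \<in> W \<Longrightarrow> b \<in> W \<Longrightarrow> a \<noteq> b \<Longrightarrow> distinct r \<Longrightarrow> set r \<inter> W = {} \<Longrightarrow>
    set (path_edges (a # r @ [b])) \<subseteq> E \<Longrightarrow> set (path_edges (a # r @ [b])) \<inter> F = {} \<Longrightarrow>
    ear_built E (W \<union> set r) (F \<union> set (path_edges (a # r @ [b])))"

lemma Union_cycle_edges: "cs \<noteq> [] \<Longrightarrow> \<Union>(set (cycle_edges cs)) = set cs"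
  unfolding cycle_edges_def using Union_path_edges[of "cs @ [hd cs]"] by (cases cs) auto

lemma ear_built_props:
  assumes "ear_built E W F"
  shows "F \<subseteq> E \<and> \<Union>F = W \<and> finite F \<and> finite W \<and> card W \<ge> 3"
  using assms
proof induction
  case (cycle cs)
  then have "cs \<noteq> []" by auto
  then show ?case using cycle Union_cycle_edges[of cs] by (simp add: distinct_card)
next
  case (ear W F a b r)
  then have "card W \<le> card (W \<union> set r)" by (intro card_mono) auto
  moreover have "\<Union>(set (path_edges (a # r @ [b]))) = insert a (insert b (set r))"
    using Union_path_edges[of "a # r @ [b]"] by auto
  ultimately show ?case using ear by (simp add: insert_absorb)
qed

section \<open>Plane drawings as sets of arcs\<close>

locale drawing =
  fixes V :: "'a set" and E :: "'a set set" and f :: "'a \<Rightarrow> complex" and \<gamma> :: "'a set \<Rightarrow> real \<Rightarrow> complex"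
  assumes edge_subset: "e \<in> E \<Longrightarrow> e \<subseteq> V"
    and inj: "inj_on f V"
    and edge_arc: "e \<in> E \<Longrightarrow> arc (\<gamma> e)"
    and edge_ends: "e \<in> E \<Longrightarrow> \<exists>u v. e = {u, v} \<and> pathstart (\<gamma> e) = f u \<and> pathfinish (\<gamma> e) = f v"
    and edge_vertices: "e \<in> E \<Longrightarrow> path_image (\<gamma> e) \<inter> f ` V = f ` e"
    and edge_meet: "e \<in> E \<Longrightarrow> e' \<in> E \<Longrightarrow> e \<noteq> e' \<Longrightarrow>
      path_image (\<gamma> e) \<inter> path_image (\<gamma> e') \<subseteq> f ` (e \<inter> e')"
begin

definition draw :: "'a set set \<Rightarrow> complex set" where
  "draw F = (\<Union>e\<in>F. path_image (\<gamma> e))"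

lemma draw_Un: "draw (F \<union> G) = draw F \<union> draw G" by (simp add: draw_def)

lemma draw_disjoint: "F \<subseteq> E \<Longrightarrow> G \<subseteq> E \<Longrightarrow> F \<inter> G = {} \<Longrightarrow> draw F \<inter> draw G \<subseteq> f ` (\<Union>F \<inter> \<Union>G)"
proof
  fix z assume FG: "F \<subseteq> E" "G \<subseteq> E" "F \<inter> G = {}" and "z \<in> draw F \<inter> draw G"
  then obtain e e' where e: "e \<in> F" "e' \<in> G" "z \<in> path_image (\<gamma> e) \<inter> path_image (\<gamma> e')"
    by (auto simp: draw_def)
  then have "e \<in> E" "e' \<in> E" "e \<noteq> e'" using FG by auto
  then have "z \<in> f ` (e \<inter> e')" using edge_meet e(3) by blast
  then show "z \<in> f ` (\<Union>F \<inter> \<Union>G)" using e(1,2) by blast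
qed

lemma draw_vertex: "F \<subseteq> E \<Longrightarrow> v \<in> \<Union>F \<Longrightarrow> f v \<in> draw F"
proof -
  assume "F \<subseteq> E" "v \<in> \<Union>F"
  then obtain e where e: "e \<in> F" "e \<in> E" "v \<in> e" by blast
  then have "f v \<in> path_image (\<gamma> e)" using edge_vertices[OF e(2)] by blast
  then show ?thesis using e(1) by (auto simp: draw_def)
qed

lemma vertex_on_draw: "F \<subseteq> E \<Longrightarrow> v \<in> V \<Longrightarrow> f v \<in> draw F \<Longrightarrow> v \<in> \<Union>F"
proof -
  assume F: "F \<subseteq> E" and v: "v \<in> V" "f v \<in> draw F"
  then obtain e where e: "e \<in> F" "f v \<in> path_image (\<gamma> e)" by (auto simp: draw_def)
  have E: "e \<in> E" using e F by blast
  have "f v \<in> f ` e" using edge_vertices[OF E] e v by blast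
  then have "v \<in> e" using inj_on_image_mem_iff[OF inj v(1) edge_subset[OF E]] by simp
  then show ?thesis using e by blast
qed

lemma edge_oriented:
  assumes "{x, y} \<in> E"
  obtains g where "arc g" "pathstart g = f x" "pathfinish g = f y" "path_image g = path_image (\<gamma> {x,y})"
proof -
  obtain u v where uv: "{x,y} = {u,v}" "pathstart (\<gamma> {x,y}) = f u" "pathfinish (\<gamma> {x,y}) = f v"
    using edge_ends[OF assms] by blast
  show thesis
  proof (cases "u = x \<and> v = y")
    case True then show ?thesis using that[OF edge_arc[OF assms]] uv(2,3) by simp
  next
    case False
    then have "u = y" "v = x" using uv(1) unfolding doubleton_eq_iff by blast+
    then show ?thesis using that[OF arc_reversepath[OF edge_arc[OF assms]]] uv(2,3) by simp
  qed
qed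

lemma path_arc:
  assumes "distinct xs" "length xs \<ge> 2" "set (path_edges xs) \<subseteq> E"
  shows "\<exists>g. arc g \<and> pathstart g = f (hd xs) \<and> pathfinish g = f (last xs) \<and>
    path_image g = draw (set (path_edges xs))"
  using assms
proof (induction xs rule: path_edges.induct)
  case (1 x y zs)
  obtain g where g: "arc g" "pathstart g = f x" "pathfinish g = f y" "path_image g = path_image (\<gamma> {x,y})"
    using edge_oriented[of x y] 1 by auto
  show ?case
  proof (cases "zs = []")
    case True then show ?thesis using g by (intro exI[of _ g]) (auto simp: draw_def)
  next
    case False
    then have len: "length (y # zs) \<ge> 2" by (cases zs) auto
    then obtain h where h: "arc h" "pathstart h = f y" "pathfinish h = f (last (y # zs))"
      "path_image h = draw (set (path_edges (y # zs)))" using 1 by auto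
    have "{x,y} \<notin> set (path_edges (y # zs))"
      using path_edges_subset[of "{x,y}" "y # zs"] 1(2) by auto
    then have "path_image g \<inter> path_image h \<subseteq> f ` (\<Union>{{x,y}} \<inter> \<Union>(set (path_edges (y # zs))))"
      using draw_disjoint[of "{{x,y}}" "set (path_edges (y # zs))"] 1(4) g(4) h(4)
      by (auto simp: draw_def)
    also have "\<dots> \<subseteq> {f y}" using Union_path_edges[OF len] 1(2) by auto
    finally have "path_image g \<inter> path_image h \<subseteq> {pathstart h}" using h(2) by simp
    then have "arc (g +++ h)" using g h by (intro arc_join) auto
    moreover have "path_image (g +++ h) = draw (set (path_edges (x # y # zs)))"
      using g h by (simp add: path_image_join draw_def)
    ultimately show ?thesis using g h by (intro exI[of _ "g +++ h"]) auto
  qed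
qed auto

lemma path_arc':
  assumes "distinct (a # r @ [b])" "set (path_edges (a # r @ [b])) \<subseteq> E"
  obtains g where "arc g" "pathstart g = f a" "pathfinish g = f b"
    "path_image g = draw (set (path_edges (a # r @ [b])))"
  using path_arc[of "a # r @ [b]"] assms by auto

lemma draw_paths_meet:
  assumes "set (path_edges (a # r @ [b])) \<subseteq> E" "set (path_edges (a # s @ [b])) \<subseteq> E"
    "set (path_edges (a # r @ [b])) \<inter> set (path_edges (a # s @ [b])) = {}"
    "set r \<inter> set s = {}" "set r \<inter> {a,b} = {}" "set s \<inter> {a,b} = {}"
  shows "draw (set (path_edges (a # r @ [b]))) \<inter> draw (set (path_edges (a # s @ [b]))) = {f a, f b}"
proof -
  have U: "\<Union>(set (path_edges (a # r @ [b]))) = {a,b} \<union> set r"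
    "\<Union>(set (path_edges (a # s @ [b]))) = {a,b} \<union> set s"
    using Union_path_edges[of "a # r @ [b]"] Union_path_edges[of "a # s @ [b]"] by auto
  have "({a,b} \<union> set r) \<inter> ({a,b} \<union> set s) = {a,b}" using assms(4-6) by blast
  then show ?thesis
    using draw_disjoint[OF assms(1-3)] draw_vertex[OF assms(1)] draw_vertex[OF assms(2)]
    unfolding U by auto
qed

end

section \<open>Faces\<close>

lemma set_cycle_edges_two_paths:
  "set (cycle_edges (a # u @ b # rev r)) = set (path_edges (a # u @ [b])) \<union> set (path_edges (a # r @ [b]))"
proof -
  have "set (path_edges (b # rev r @ [a])) = set (path_edges (a # r @ [b]))"
    using path_edges_rev[of "a # r @ [b]"] by simp
  then show ?thesis by (simp add: cycle_edges_append)
qed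

lemma is_cycle_two_paths:
  assumes "distinct (a # u @ b # rev r)" "set (a # u @ b # rev r) \<subseteq> V"
    "set (path_edges (a # u @ [b])) \<subseteq> E" "set (path_edges (a # r @ [b])) \<subseteq> E"
    "set (path_edges (a # u @ [b])) \<inter> set (path_edges (a # r @ [b])) = {}"
  shows "is_cycle V E (a # u @ b # rev r)"
proof -
  have "\<not> (u = [] \<and> r = [])" using assms(5) by auto
  then have "length (a # u @ b # rev r) \<ge> 3" by (cases u; cases r) auto
  then show ?thesis
    using assms unfolding is_cycle_iff set_cycle_edges_two_paths by blast
qed

context drawing begin

text \<open>The first edge and the rest of the cycle are two arcs with the same ends and nothing
  else in common.\<close>

lemma cycle_closed_curve:
  assumes "is_cycle V E cs"
  shows "closed_curve (draw (set (cycle_edges cs)))"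
proof -
  have cs: "distinct cs" "length cs \<ge> 3" "set (cycle_edges cs) \<subseteq> E"
    using assms by (auto simp: is_cycle_iff)
  obtain a b w where w: "cs = a # b # w"
    using cs(2) unfolding numeral_3_eq_3 Suc_le_length_iff by blast
  \<comment> \<open>Reversing the rest makes both arcs run from \<open>a\<close> to
    \<open>b\<close>.\<close>
  define r where "r = rev w"
  have cs': "cs = a # [] @ b # rev r" by (simp add: w r_def)
  have ce: "set (cycle_edges cs) = set (path_edges (a # [] @ [b])) \<union> set (path_edges (a # r @ [b]))"
    unfolding cs' by (rule set_cycle_edges_two_paths)
  have "distinct (path_edges (a # [] @ [b]) @ path_edges (b # rev r @ [a]))"
    using distinct_cycle_edges[OF cs(1,2)] unfolding cs' cycle_edges_append .
  then have dj: "set (path_edges (a # [] @ [b])) \<inter> set (path_edges (a # r @ [b])) = {}"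
    using path_edges_rev[of "a # r @ [b]"] by simp
  have E: "set (path_edges (a # [] @ [b])) \<subseteq> E" "set (path_edges (a # r @ [b])) \<subseteq> E"
    using ce cs(3) by auto
  have d: "distinct (a # [] @ [b])" "distinct (a # r @ [b])" using cs(1) unfolding cs' by auto
  obtain g where g: "arc g" "pathstart g = f a" "pathfinish g = f b"
    "path_image g = draw (set (path_edges (a # [] @ [b])))" using path_arc'[OF d(1) E(1)] by blast
  obtain h where h: "arc h" "pathstart h = f a" "pathfinish h = f b"
    "path_image h = draw (set (path_edges (a # r @ [b])))" using path_arc'[OF d(2) E(2)] by blast
  have "path_image g \<inter> path_image h = {f a, f b}"
    unfolding g h by (rule draw_paths_meet[OF E dj]) (use d in auto)
  then show ?thesis
    using closed_curve_join[of g h "f a" "f b"] g h unfolding ce draw_Un by simp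
qed

text \<open>Euler's formula in a form that can be carried along an ear decomposition.
  \<open>C\<close> chooses a boundary cycle for each face; the sum says that every edge is counted
  on two faces, and the last equation is n - m + f = 2 without subtraction.\<close>

definition face_system :: "'a set \<Rightarrow> 'a set set \<Rightarrow> complex set set \<Rightarrow> (complex set \<Rightarrow> 'a list) \<Rightarrow> bool" where
  "face_system W F \<S> C \<longleftrightarrow> finite \<S> \<and> pairwise disjnt \<S> \<and> \<Union>\<S> = - draw F \<and>
     (\<forall>S\<in>\<S>. is_cycle W F (C S) \<and> side_of (draw (set (cycle_edges (C S)))) S) \<and>
     (\<Sum>S\<in>\<S>. length (C S)) = 2 * card F \<and> card \<S> + card W = card F + 2"

lemma face_system_cycle:
  assumes "is_cycle V E cs"
  shows "\<exists>\<S> C. face_system (set cs) (set (cycle_edges cs)) \<S> C"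
proof -
  let ?J = "draw (set (cycle_edges cs))"
  have cs: "distinct cs" "length cs \<ge> 3" using assms by (auto simp: is_cycle_iff)
  have card: "card (set (cycle_edges cs)) = length cs" "card (set cs) = length cs"
    using distinct_cycle_edges[OF cs] cs by (auto simp: distinct_card length_cycle_edges)
  have cyc: "is_cycle (set cs) (set (cycle_edges cs)) cs" using cs by (simp add: is_cycle_iff)
  note J = closed_curve_sides[OF cycle_closed_curve[OF assms]]
  have ne: "inside ?J \<noteq> outside ?J" using J(1,3) by (metis Int_absorb side_of_def)
  have dj: "pairwise disjnt {inside ?J, outside ?J}"
    by (simp add: pairwise_insert disjnt_def Int_commute)
  show ?thesis
    by (intro exI[of _ "{inside ?J, outside ?J}"] exI[of _ "\<lambda>_. cs"])
      (use J ne dj card cyc in \<open>simp add: face_system_def\<close>)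
qed

text \<open>The ear without its ends is connected and avoids the old drawing, so it lies in one face
  \<open>S\<close>. Its ends are limits of it and belong to the drawing, so they lie on the boundary
  cycle of \<open>S\<close>. Cutting this cycle at \<open>a\<close> and \<open>b\<close> yields a
  theta curve, and \<open>theta_split\<close> replaces \<open>S\<close> by two faces.\<close>

lemma face_system_ear:
  assumes fs: "face_system W F \<S> C" and F: "F \<subseteq> E" "finite F" "\<Union>F = W" "finite W"
    and ab: "a \<in> W" "b \<in> W" "a \<noteq> b" and r: "distinct r" "set r \<inter> W = {}"
    and P: "set (path_edges (a # r @ [b])) \<subseteq> E" "set (path_edges (a # r @ [b])) \<inter> F = {}"
  shows "\<exists>\<S>' C'. face_system (W \<union> set r) (F \<union> set (path_edges (a # r @ [b]))) \<S>' C'"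
proof -
  let ?P = "set (path_edges (a # r @ [b]))"
  have \<S>: "finite \<S>" "pairwise disjnt \<S>" "\<Union>\<S> = - draw F"
    "\<And>S. S \<in> \<S> \<Longrightarrow> is_cycle W F (C S)" "\<And>S. S \<in> \<S> \<Longrightarrow> side_of (draw (set (cycle_edges (C S)))) S"
    "(\<Sum>S\<in>\<S>. length (C S)) = 2 * card F" "card \<S> + card W = card F + 2"
    using fs by (auto simp: face_system_def)
  have op: "open S" if "S \<in> \<S>" for S using \<S>(5)[OF that] by (simp add: side_of_def)
  have WV: "W \<subseteq> V" using F edge_subset by blast
  have dP: "distinct (a # r @ [b])" using ab r by auto
  obtain g where g: "arc g" "pathstart g = f a" "pathfinish g = f b" "path_image g = draw ?P"
    using path_arc'[OF dP P(1)] .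
  have UP: "\<Union>?P = {a,b} \<union> set r" using Union_path_edges[of "a # r @ [b]"] by auto
  have "\<Union>?P \<inter> \<Union>F = {a,b}" using UP F(3) ab r by blast
  then have PF: "draw ?P \<inter> draw F \<subseteq> {f a, f b}" using draw_disjoint[OF P(1) F(1) P(2)] by auto
  let ?X = "draw ?P - {f a, f b}"
  have X: "connected ?X" "?X \<noteq> {}" "?X \<subseteq> \<Union>\<S>"
    using connected_simple_path_endless[of g] nonempty_simple_path_endless[of g] g PF \<S>(3)
    by (auto simp: arc_imp_simple_path)
  obtain S where S: "S \<in> \<S>" "?X \<inter> S \<noteq> {}" using X by blast
  have XS: "?X \<subseteq> S"
  proof (rule connected_subset_open_part[OF X(1) op[OF S(1)] _ _ _ S(2)])
    show "open (\<Union>(\<S> - {S}))" using op by blast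
    show "S \<inter> \<Union>(\<S> - {S}) = {}" using \<S>(2) S(1) by (auto simp: pairwise_def disjnt_def)
    show "?X \<subseteq> S \<union> \<Union>(\<S> - {S})" using X(3) by blast
  qed
  let ?K = "set (cycle_edges (C S))"
  note side = \<S>(5)[OF S(1)] and cyc = \<S>(4)[OF S(1)]
  have cS: "distinct (C S)" "length (C S) \<ge> 3" "set (C S) \<subseteq> W" "?K \<subseteq> F"
    using cyc by (auto simp: is_cycle_iff)
  then have "C S \<noteq> []" by auto
  then have UK: "\<Union>?K = set (C S)" by (rule Union_cycle_edges)
  have on: "x \<in> set (C S)" if x: "x \<in> W" "f x \<in> closure ?X" for x
  proof -
    have "f x \<in> closure S" using closure_mono[OF XS] x by blast
    moreover have "f x \<in> draw F" using draw_vertex[OF F(1)] F(3) x by blast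
    then have "f x \<notin> S" using \<S>(3) S(1) by blast
    ultimately have "f x \<in> draw ?K" using side by (auto simp: side_of_def closure_Un_frontier)
    then show ?thesis using vertex_on_draw[of ?K x] x WV cS(4) F(1) UK by blast
  qed
  have "a \<in> set (C S)" "b \<in> set (C S)"
    using on[of a] on[of b] ab pathstart_in_closure_interior[OF g(1)] unfolding g by auto
  then obtain u v where uv: "mset (cycle_edges (C S)) = mset (cycle_edges (a # u @ b # v))"
    "mset (C S) = mset (a # u @ b # v)"
    using cycle_through_two[OF _ _ ab(3)] by metis
  define w where "w = rev v"
  let ?A = "set (path_edges (a # u @ [b]))" and ?B = "set (path_edges (a # w @ [b]))"
  have v: "v = rev w" by (simp add: w_def)
  have K: "?K = ?A \<union> ?B"
    using uv(1) unfolding v by (metis set_cycle_edges_two_paths set_mset_mset)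
  have duv: "distinct (a # u @ b # rev w)"
    using cS(1) uv(2) unfolding v by (metis mset_eq_imp_distinct_iff)
  have suv: "set (a # u @ b # rev w) \<subseteq> W"
    using cS(3) uv(2) unfolding v by (metis set_mset_mset)
  have luv: "length (C S) = length u + length w + 2"
    using arg_cong[OF uv(2), of size] unfolding v by simp
  have "distinct (cycle_edges (a # u @ b # rev w))"
    using distinct_cycle_edges[OF cS(1,2)] uv(1) unfolding v by (metis mset_eq_imp_distinct_iff)
  then have AB: "?A \<inter> ?B = {}"
    using path_edges_rev[of "a # w @ [b]"] by (simp add: cycle_edges_append)
  have AF: "?A \<subseteq> F" "?B \<subseteq> F" using K cS(4) by auto
  then have E: "?A \<subseteq> E" "?B \<subseteq> E" using F by auto
  have AP: "?A \<inter> ?P = {}" "?B \<inter> ?P = {}" using AF P(2) by auto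
  have d: "distinct (a # u @ [b])" "distinct (a # w @ [b])" using duv by auto
  obtain g1 where g1: "arc g1" "pathstart g1 = f a" "pathfinish g1 = f b" "path_image g1 = draw ?A"
    using path_arc'[OF d(1) E(1)] .
  obtain g2 where g2: "arc g2" "pathstart g2 = f a" "pathfinish g2 = f b" "path_image g2 = draw ?B"
    using path_arc'[OF d(2) E(2)] .
  have m: "path_image g1 \<inter> path_image g2 = {f a, f b}"
    "path_image g1 \<inter> path_image g = {f a, f b}" "path_image g2 \<inter> path_image g = {f a, f b}"
    unfolding g1 g2 g
    by (rule draw_paths_meet[OF E AB] draw_paths_meet[OF E(1) P(1) AP(1)]
        draw_paths_meet[OF E(2) P(1) AP(2)]; use duv suv r dP in auto)+
  have s: "side_of (path_image g1 \<union> path_image g2) S" "path_image g - {f a, f b} \<subseteq> S"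
    using side XS unfolding K draw_Un g1 g2 g by auto
  obtain S1 S2 where S12: "side_of (draw ?A \<union> draw ?P) S1" "side_of (draw ?B \<union> draw ?P) S2"
    "S1 \<inter> S2 = {}" "S1 \<union> S2 = S - draw ?P"
    using theta_split[OF g1(1) g2(1) g(1) g1(2,3) g2(2,3) g(2,3) m s] unfolding g1 g2 g by blast
  let ?c1 = "a # u @ b # rev r" and ?c2 = "a # w @ b # rev r"
  let ?W = "W \<union> set r" and ?F = "F \<union> ?P"
  have cyc1: "is_cycle ?W ?F ?c1"
    by (rule is_cycle_two_paths) (use duv suv r dP AF AP in auto)
  have cyc2: "is_cycle ?W ?F ?c2"
    by (rule is_cycle_two_paths) (use duv suv r dP AF AP in auto)
  have ne: "S1 \<noteq> {}" "S2 \<noteq> {}" using S12(1,2) by (auto simp: side_of_def)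
  have dis: "T \<inter> S = {}" if "T \<in> \<S> - {S}" for T
    using \<S>(2) S(1) that by (auto simp: pairwise_def disjnt_def)
  have S12S: "S1 \<subseteq> S" "S2 \<subseteq> S" using S12(4) by auto
  \<comment> \<open>The new faces are nonempty parts of \<open>S\<close>, which the other faces
    avoid. Hence they are not among those, and changing \<open>C\<close> at \<open>S1\<close> and
    \<open>S2\<close> leaves the other boundary cycles alone.\<close>
  have new: "S1 \<notin> \<S> - {S}" "S2 \<notin> \<S> - {S}" "S1 \<noteq> S2"
    using dis[of S1] dis[of S2] ne S12S S12(3) by auto
  let ?C = "C(S1 := ?c1, S2 := ?c2)"
  have "pairwise disjnt (insert S1 (insert S2 (\<S> - {S})))"
  proof -
    have "pairwise disjnt (\<S> - {S})" using pairwise_subset[OF \<S>(2)] by blast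
    moreover have "T \<inter> S1 = {}" "T \<inter> S2 = {}" if "T \<in> \<S> - {S}" for T
      using dis[OF that] S12S by blast+
    ultimately show ?thesis
      using S12(3) unfolding pairwise_insert disjnt_def by (metis Int_commute insert_iff)
  qed
  \<comment> \<open>Apart from points of the old drawing the ear lies in \<open>S\<close>, so
    removing it changes no other face.\<close>
  moreover have "\<Union>(insert S1 (insert S2 (\<S> - {S}))) = - draw ?F"
  proof -
    have "{f a, f b} \<subseteq> draw F" using draw_vertex[OF F(1)] F(3) ab by simp
    then have PS: "draw ?P \<subseteq> S \<union> draw F" using XS by blast
    have "T \<inter> draw ?P = {}" if T: "T \<in> \<S> - {S}" for T
    proof -
      have "T \<inter> draw F = {}" using \<S>(3) T by blast
      then show ?thesis using dis[OF T] PS by blast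
    qed
    then have dj: "\<Union>(\<S> - {S}) \<inter> draw ?P = {}" by (simp only: Int_Union2) simp
    have "\<Union>\<S> = S \<union> \<Union>(\<S> - {S})" using S(1) by blast
    moreover have "\<Union>(insert S1 (insert S2 (\<S> - {S}))) = (S1 \<union> S2) \<union> \<Union>(\<S> - {S})"
      by (simp add: Un_assoc)
    ultimately have "\<Union>(insert S1 (insert S2 (\<S> - {S}))) = \<Union>\<S> - draw ?P"
      unfolding S12(4) using dj by (simp add: Un_Diff Diff_triv)
    then show ?thesis using \<S>(3) by (auto simp: draw_Un)
  qed
  moreover have "\<forall>T\<in>insert S1 (insert S2 (\<S> - {S})). is_cycle ?W ?F (?C T) \<and>
      side_of (draw (set (cycle_edges (?C T)))) T"
  proof
    fix T assume "T \<in> insert S1 (insert S2 (\<S> - {S}))"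
    then consider "T = S1" | "T = S2" | "T \<in> \<S> - {S}" by blast
    then show "is_cycle ?W ?F (?C T) \<and> side_of (draw (set (cycle_edges (?C T)))) T"
    proof cases
      case 1
      have "side_of (draw (set (cycle_edges ?c1))) S1"
        using S12(1) unfolding set_cycle_edges_two_paths draw_Un .
      moreover have "?C T = ?c1" using new(3) 1 by simp
      ultimately show ?thesis using cyc1 unfolding 1 by simp
    next
      case 2
      have "side_of (draw (set (cycle_edges ?c2))) S2"
        using S12(2) unfolding set_cycle_edges_two_paths draw_Un .
      moreover have "?C T = ?c2" using 2 by simp
      ultimately show ?thesis using cyc2 unfolding 2 by simp
    next
      case 3
      then have "T \<noteq> S1" "T \<noteq> S2" "T \<in> \<S>" using new by auto
      then show ?thesis using \<S>(4,5)[of T] is_cycle_mono[of W F "C T" ?W ?F] by simp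
    qed
  qed
  moreover have cardP: "card ?F = card F + length r + 1"
    using card_Un_disjoint[of F ?P] F(2) P(2) distinct_path_edges[OF dP]
    by (simp add: distinct_card Int_commute length_path_edges del: path_edges.simps)
  \<comment> \<open>The old boundary is shared out between the two new cycles and each ear edge is
    on both, so the total grows by twice the number \<open>length r + 1\<close> of ear
    edges.\<close>
  moreover have "(\<Sum>T\<in>insert S1 (insert S2 (\<S> - {S})). length (?C T)) = 2 * card ?F"
  proof -
    have "(\<Sum>T\<in>\<S> - {S}. length (?C T)) = (\<Sum>T\<in>\<S> - {S}. length (C T))"
      using new by (intro sum.cong) auto
    moreover have "(\<Sum>T\<in>\<S>. length (C T)) = length (C S) + (\<Sum>T\<in>\<S> - {S}. length (C T))"
      by (rule sum.remove[OF \<S>(1) S(1)])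
    ultimately show ?thesis
      using \<S>(1,6) new luv cardP by simp
  qed
  moreover have "card (insert S1 (insert S2 (\<S> - {S}))) = card \<S> + 1"
    using \<S>(1) new S(1) card_Suc_Diff1[OF \<S>(1) S(1)] by simp
  moreover have "card ?W = card W + length r"
    using card_Un_disjoint[of W "set r"] F(4) r by (simp add: Int_commute distinct_card)
  ultimately have "face_system ?W ?F (insert S1 (insert S2 (\<S> - {S}))) ?C"
    using \<S>(1,7) unfolding face_system_def by simp
  then show ?thesis by blast
qed

lemma face_system_ear_built:
  assumes "ear_built E W F"
  shows "\<exists>\<S> C. face_system W F \<S> C"
  using assms
proof induction
  case (cycle cs)
  then have "cs \<noteq> []" by auto
  then have "set cs \<subseteq> V" using Union_cycle_edges[of cs] cycle(3) edge_subset by blast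
  then show ?case using face_system_cycle[of cs] cycle by (simp add: is_cycle_iff)
next
  case (ear W F a b r)
  then obtain \<S> C where "face_system W F \<S> C" by blast
  then show ?case using face_system_ear[of W F \<S> C a b r] ear ear_built_props[OF ear(1)] by simp
qed

text \<open>There are m - n + 2 faces, each of length at least \<open>g\<close>, and their lengths
  add up to 2m. The inequality is rearranged to avoid subtraction of naturals.\<close>

lemma ear_built_edge_bound:
  assumes "ear_built E W F" and girth: "\<And>cs. is_cycle V E cs \<Longrightarrow> g \<le> length cs"
  shows "g * (card F + 2) \<le> 2 * card F + g * card W"
proof -
  obtain \<S> C where fs: "face_system W F \<S> C" using face_system_ear_built[OF assms(1)] by blast
  have "W \<subseteq> V" "F \<subseteq> E" using ear_built_props[OF assms(1)] edge_subset by blast+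
  then have "g \<le> length (C S)" if "S \<in> \<S>" for S
    using girth is_cycle_mono[of W F "C S" V E] fs that unfolding face_system_def by blast
  then have "(\<Sum>S\<in>\<S>. g) \<le> (\<Sum>S\<in>\<S>. length (C S))" by (intro sum_mono)
  then have "g * card \<S> \<le> 2 * card F" using fs by (simp add: face_system_def mult.commute)
  moreover have "g * (card F + 2) = g * card \<S> + g * card W"
    using fs by (metis face_system_def distrib_left)
  ultimately show ?thesis by simp
qed

end

section \<open>Planar graphs of girth at least six\<close>

lemma graph_edge:
  assumes "graph V E" "e \<in> E" "x \<in> e"
  obtains y where "e = {x, y}" "y \<noteq> x" "y \<in> V" "x \<in> V"
proof -
  have "e \<subseteq> V" "card e = 2" using assms by (auto simp: graph_def)
  then obtain a b where "e = {a,b}" "a \<noteq> b" by (auto simp: card_2_iff)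
  then show thesis using that[of a] that[of b] assms(3) \<open>e \<subseteq> V\<close> by auto
qed

lemma graph_finite_edges: "graph V E \<Longrightarrow> finite E"
  by (rule finite_subset[of E "Pow V"]) (auto simp: graph_def)

lemma graph_subgraph: "graph V E \<Longrightarrow> V' \<subseteq> V \<Longrightarrow> E' \<subseteq> E \<Longrightarrow> \<Union>E' \<subseteq> V' \<Longrightarrow> graph V' E'"
  unfolding graph_def by (meson Sup_le_iff finite_subset subsetD)

lemma planar_imp_drawing:
  assumes "graph V E" "planar V E"
  shows "\<exists>f \<gamma>. drawing V E f \<gamma>"
proof -
  obtain f :: "'a \<Rightarrow> complex" and \<gamma> where f: "inj_on f V"
    and 1: "\<forall>e\<in>E. arc (\<gamma> e) \<and> (\<exists>u v. e = {u, v} \<and> pathstart (\<gamma> e) = f u \<and> pathfinish (\<gamma> e) = f v) \<and>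
        path_image (\<gamma> e) \<inter> f ` V = f ` e"
    and 2: "\<forall>e\<in>E. \<forall>e'\<in>E. e \<noteq> e' \<longrightarrow> path_image (\<gamma> e) \<inter> path_image (\<gamma> e') \<subseteq> f ` (e \<inter> e')"
    using assms(2) unfolding planar_def by (elim exE conjE)
  have "e \<subseteq> V" if "e \<in> E" for e using assms(1) that by (simp add: graph_def)
  then have "drawing V E f \<gamma>"
    by (rule drawing.intro) (use f 1 2 in \<open>simp_all only: simp_thms\<close>)
  then show ?thesis by (intro exI)
qed

lemma (in drawing) planar: "planar V E"
  unfolding planar_def
  by (intro exI[of _ f] exI[of _ \<gamma>] conjI ballI impI inj edge_arc edge_ends edge_vertices edge_meet)

lemma (in drawing) subdrawing:
  assumes "V' \<subseteq> V" "E' \<subseteq> E" "\<Union>E' \<subseteq> V'"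
  shows "drawing V' E' f \<gamma>"
proof
  show "inj_on f V'" using inj assms(1) by (rule inj_on_subset)
  fix e assume e: "e \<in> E'"
  then have E: "e \<in> E" using assms by blast
  show V': "e \<subseteq> V'" using e assms(3) by blast
  show "arc (\<gamma> e)" "\<exists>u v. e = {u, v} \<and> pathstart (\<gamma> e) = f u \<and> pathfinish (\<gamma> e) = f v"
    by (rule edge_arc[OF E] edge_ends[OF E])+
  have "f ` e \<subseteq> f ` V'" "f ` V' \<subseteq> f ` V" using V' assms(1) by (auto intro: image_mono)
  then show "path_image (\<gamma> e) \<inter> f ` V' = f ` e" using edge_vertices[OF E] by blast
  fix e' assume "e' \<in> E'" "e \<noteq> e'"
  then show "path_image (\<gamma> e) \<inter> path_image (\<gamma> e') \<subseteq> f ` (e \<inter> e')"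
    using edge_meet[OF E] assms(2) by (simp add: subsetD)
qed

lemma planar_subgraph:
  assumes "graph V E" "planar V E" "V' \<subseteq> V" "E' \<subseteq> E" "\<Union>E' \<subseteq> V'"
  shows "planar V' E'"
  using planar_imp_drawing[OF assms(1,2)] drawing.subdrawing[OF _ assms(3-5)] drawing.planar by metis

section \<open>Ear decompositions of graphs that cannot be split at a vertex\<close>

lemma degree_ge_2_other_edge:
  assumes "degree E x \<ge> 2"
  shows "\<exists>e\<in>E. x \<in> e \<and> e \<noteq> e0"
proof (rule ccontr)
  assume "\<not> ?thesis"
  then have "{e \<in> E. x \<in> e} \<subseteq> {e0}" by blast
  then have "degree E x \<le> card {e0}" unfolding degree_def by (intro card_mono) auto
  then show False using assms by simp
qed

text \<open>The first vertex of a longest path has a second edge, which by maximality leads back to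
  the path.\<close>

lemma ex_cycle_of_min_degree_2:
  assumes G: "graph V E" "V \<noteq> {}" and deg: "\<And>v. v \<in> V \<Longrightarrow> degree E v \<ge> 2"
  shows "\<exists>cs. is_cycle V E cs"
proof -
  obtain v where "v \<in> V" using G(2) by blast
  then have 0: "is_path V E [v]" by (simp add: is_path_iff)
  have fin: "finite V" using G(1) by (simp add: graph_def)
  have "length xs < Suc (card V)" if "is_path V E xs" for xs
  proof -
    have "card (set xs) \<le> card V" using that fin by (intro card_mono) (auto simp: is_path_iff)
    then show ?thesis using that by (auto simp: is_path_iff distinct_card)
  qed
  then obtain xs where xs: "is_path V E xs" and max: "\<And>ys. is_path V E ys \<Longrightarrow> length ys \<le> length xs"
    using ex_has_greatest_nat[of "is_path V E" "[v]" length "Suc (card V)"] 0 by auto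
  obtain x ys where x: "xs = x # ys" using xs by (cases xs) (auto simp: is_path_iff)
  have "x \<in> V" using xs x by (simp add: is_path_iff)
  \<comment> \<open>For empty \<open>ys\<close> the value \<open>hd ys\<close> is unspecified, which
    is harmless: any other edge at \<open>x\<close> then extends the path and contradicts
    maximality. Otherwise the exclusion of the first path edge makes the cycle have at least three
    vertices.\<close>
  obtain e where e: "e \<in> E" "x \<in> e" "e \<noteq> {x, hd ys}"
    using degree_ge_2_other_edge[OF deg[OF \<open>x \<in> V\<close>]] by blast
  obtain z where z: "e = {x,z}" "z \<noteq> x" "z \<in> V" using graph_edge[OF G(1) e(1,2)] by blast
  have "z \<in> set ys"
  proof (rule ccontr)
    assume "z \<notin> set ys"
    then have "is_path V E (z # xs)" using xs x z e by (auto simp: is_path_iff insert_commute)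
    then show False using max by fastforce
  qed
  then obtain s t where st: "ys = s @ z # t" by (meson split_list)
  have "s \<noteq> []" using e(3) z st by auto
  have "set (path_edges ((x # s) @ [z])) \<subseteq> E"
    using xs path_edges_split[of "x # s" z t] unfolding x st by (auto simp: is_path_iff)
  moreover have "cycle_edges (x # s @ [z]) = path_edges ((x # s) @ [z]) @ [{z,x}]"
    using path_edges_split[of "x # s" z "[x]"] by (simp add: cycle_edges_def)
  ultimately have "set (cycle_edges (x # s @ [z])) \<subseteq> E" using e z by (auto simp: insert_commute)
  then have "is_cycle V E (x # s @ [z])"
    using xs \<open>s \<noteq> []\<close> unfolding x st is_cycle_iff is_path_iff by (cases s) auto
  then show ?thesis by blast
qed

text \<open>When the walk returns to a vertex of the path, the path is cut back to that
  vertex.\<close>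

lemma reachable_path:
  assumes "(\<lambda>x y. {x,y} \<in> E \<and> x \<notin> W \<and> y \<notin> W)\<^sup>*\<^sup>* x y" "x \<notin> W"
  shows "\<exists>xs. xs \<noteq> [] \<and> distinct xs \<and> hd xs = x \<and> last xs = y \<and> set xs \<inter> W = {} \<and>
    set (path_edges xs) \<subseteq> E"
  using assms(1)
proof induction
  case base
  show ?case using assms(2) by (intro exI[of _ "[x]"]) auto
next
  case (step y z)
  then obtain xs where xs: "xs \<noteq> []" "distinct xs" "hd xs = x" "last xs = y" "set xs \<inter> W = {}"
    "set (path_edges xs) \<subseteq> E" by blast
  show ?case
  proof (cases "z \<in> set xs")
    case True
    then obtain s t where st: "xs = s @ z # t" by (meson split_list)
    then have "hd (s @ [z]) = x" using xs(3) by (cases s) auto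
    then show ?thesis using xs path_edges_split[of s z t] unfolding st
      by (intro exI[of _ "s @ [z]"]) auto
  next
    case False
    obtain s where s: "xs = s @ [y]" using xs(1,4) by (metis append_butlast_last_id)
    have "set (path_edges (xs @ [z])) \<subseteq> E"
      using xs step(2) path_edges_split[of s y "[z]"] unfolding s by auto
    then show ?thesis using xs False step(2) by (intro exI[of _ "xs @ [z]"]) auto
  qed
qed

text \<open>An empty intersection covers disconnected graphs, a singleton cut vertices. For at least
  three vertices the negation is 2-connectedness.\<close>

definition one_separable :: "'a set \<Rightarrow> 'a set set \<Rightarrow> bool" where
  "one_separable V E \<longleftrightarrow> (\<exists>A B. A \<union> B = V \<and> A \<noteq> V \<and> B \<noteq> V \<and> card (A \<inter> B) \<le> 1 \<and>
     (\<forall>e\<in>E. e \<subseteq> A \<or> e \<subseteq> B))"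

text \<open>A vertex of degree at most 1 together with its possible neighbour can be split off from
  \<open>V - {v}\<close>; three vertices are needed for both parts to be proper.\<close>

lemma min_degree_2_or_separable:
  assumes G: "graph V E" "card V \<ge> 3" and ns: "\<not> one_separable V E" and v: "v \<in> V"
  shows "degree E v \<ge> 2"
proof (rule ccontr)
  assume "\<not> ?thesis"
  then have "card {e \<in> E. v \<in> e} \<le> Suc 0" unfolding degree_def by linarith
  moreover have "finite {e \<in> E. v \<in> e}" using graph_finite_edges[OF G(1)] by simp
  ultimately have "\<forall>e\<in>{e \<in> E. v \<in> e}. \<forall>e'\<in>{e \<in> E. v \<in> e}. e = e'"
    using card_le_Suc0_iff_eq by blast
  then have le1: "e = e'" if "e \<in> E" "v \<in> e" "e' \<in> E" "v \<in> e'" for e e' using that by blast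
  have e: "e \<subseteq> V" "card e = 2" if "e \<in> E" for e using G that by (auto simp: graph_def)
  obtain A where A: "A \<subseteq> V" "v \<in> A" "card A \<le> 2" and e0: "\<And>e. e \<in> E \<Longrightarrow> v \<in> e \<Longrightarrow> e \<subseteq> A"
  proof (cases "\<exists>e\<in>E. v \<in> e")
    case True
    then obtain e0 where "e0 \<in> E" "v \<in> e0" by blast
    moreover from this have "e \<subseteq> e0" if "e \<in> E" "v \<in> e" for e using le1 that by blast
    ultimately show ?thesis using that[of e0] e[of e0] by simp
  next
    case False
    then show ?thesis using that[of "{v}"] v by simp
  qed
  have "finite A" using A(1) G(1) by (metis finite_subset graph_def)
  have "A \<noteq> V" using A(3) G(2) by auto
  moreover have "A \<inter> (V - {v}) = A - {v}" using A by blast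
  moreover have "card (A - {v}) \<le> 1" using A \<open>finite A\<close> by simp
  moreover have "\<forall>e\<in>E. e \<subseteq> A \<or> e \<subseteq> V - {v}" using e0 e(1) by blast
  moreover have "A \<union> (V - {v}) = V" "V - {v} \<noteq> V" using A v by blast+
  ultimately have "one_separable V E"
    unfolding one_separable_def by (intro exI[of _ A] exI[of _ "V - {v}"]) simp
  then show False using ns by simp
qed

text \<open>Whitney's ear decomposition. In an ear-built subgraph with the most edges no further ear
  can be added. A component of the rest attached at two vertices of \<open>W\<close> would contain
  an ear, and one attached at fewer would give a separation; so \<open>W = V\<close>, and a missing
  edge would itself be an ear.\<close>

lemma ear_built_of_not_separable:
  assumes G: "graph V E" "card V \<ge> 3" and ns: "\<not> one_separable V E"
  shows "ear_built E V E"
proof -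
  have fin: "finite V" "finite E" using G(1) graph_finite_edges[OF G(1)] by (simp_all add: graph_def)
  have EV: "e \<subseteq> V" if "e \<in> E" for e using G(1) that by (simp add: graph_def)
  have "V \<noteq> {}" using G(2) by auto
  then obtain cs where cs: "is_cycle V E cs"
    using ex_cycle_of_min_degree_2[OF G(1) _ min_degree_2_or_separable[OF G ns]] by meson
  define Q where "Q F \<longleftrightarrow> (\<exists>W. ear_built E W F)" for F
  have "ear_built E (set cs) (set (cycle_edges cs))"
    using cs by (intro ear_built.cycle) (simp_all add: is_cycle_iff)
  then have Q0: "Q (set (cycle_edges cs))" unfolding Q_def by (rule exI)
  have "\<forall>F. Q F \<longrightarrow> card F < Suc (card E)"
  proof (intro allI impI)
    fix F assume "Q F"
    then obtain W where "ear_built E W F" unfolding Q_def by (elim exE)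
    then show "card F < Suc (card E)"
      using ear_built_props card_mono[OF fin(2)] by (metis less_Suc_eq_le)
  qed
  then obtain F where F: "Q F" "\<forall>F'. Q F' \<longrightarrow> card F' \<le> card F"
    using ex_has_greatest_nat[where P = Q and f = card, OF Q0] by blast
  then obtain W where eb: "ear_built E W F" unfolding Q_def by (elim exE conjE)
  have max: "card F' \<le> card F" if "ear_built E W' F'" for W' F'
    using F(2) that unfolding Q_def by blast
  have WF: "F \<subseteq> E" "\<Union>F = W" "finite F" "finite W" "card W \<ge> 3"
    using ear_built_props[OF eb] by auto
  have WV: "W \<subseteq> V" using WF EV by blast
  have no_ear: False if "a \<in> W" "b \<in> W" "a \<noteq> b" "distinct r" "set r \<inter> W = {}"
    "set (path_edges (a # r @ [b])) \<subseteq> E" "set (path_edges (a # r @ [b])) \<inter> F = {}" for a b r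
  proof -
    let ?P = "set (path_edges (a # r @ [b]))"
    have "?P \<noteq> {}" by (cases r) auto
    then have "card ?P > 0" by (simp add: card_gt_0_iff del: set_empty)
    moreover have "card (F \<union> ?P) = card F + card ?P"
      using that(7) by (intro card_Un_disjoint[OF WF(3)]) (simp_all add: Int_commute)
    ultimately show False using max[OF ear_built.ear[OF eb that]] by linarith
  qed
  have W: "W = V"
  proof (rule ccontr)
    assume "W \<noteq> V"
    then obtain u where u: "u \<in> V" "u \<notin> W" using WV by blast
    \<comment> \<open>\<open>K\<close> is the component of \<open>u\<close> after deletion of
      \<open>W\<close>, and \<open>N\<close> is the set of vertices of \<open>W\<close> adjacent to
      it.\<close>
    define R where "R = (\<lambda>x y. {x,y} \<in> E \<and> x \<notin> W \<and> y \<notin> W)"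
    define K where "K = {y. R\<^sup>*\<^sup>* u y}"
    define N where "N = {w \<in> W. \<exists>k\<in>K. {k,w} \<in> E}"
    have "symp R" unfolding R_def by (rule sympI) (metis insert_commute)
    then have symR: "R\<^sup>*\<^sup>* y x" if "R\<^sup>*\<^sup>* x y" for x y
      using sympD[OF symp_rtranclp] that by metis
    have uK: "u \<in> K" by (simp add: K_def)
    have Kstep: "y \<in> K" if "x \<in> K" "{x,y} \<in> E" "y \<notin> W" "x \<notin> W" for x y
    proof -
      have "R x y" using that by (simp add: R_def)
      then show ?thesis using that(1) rtranclp.rtrancl_into_rtrancl[of R u x y] by (simp add: K_def)
    qed
    have K: "y \<notin> W \<and> y \<in> V" if "y \<in> K" for y
    proof -
      have "R\<^sup>*\<^sup>* u y" using that by (simp add: K_def)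
      then show ?thesis
      proof (induction rule: rtranclp_induct)
        case (step y z)
        then show ?case using EV[of "{y,z}"] unfolding R_def by simp
      qed (simp add: u)
    qed
    then have KW: "K \<inter> W = {}" and KV: "K \<subseteq> V" by auto
    have "card N \<le> Suc 0"
    proof -
      have "a = b" if abN: "a \<in> N" "b \<in> N" for a b
      proof (rule ccontr)
        assume ne: "a \<noteq> b"
        obtain k l where kl: "k \<in> K" "{k,a} \<in> E" "l \<in> K" "{l,b} \<in> E" "a \<in> W" "b \<in> W"
          using abN unfolding N_def by blast
        have "R\<^sup>*\<^sup>* u k" "R\<^sup>*\<^sup>* u l" using kl by (simp_all add: K_def)
        then have "R\<^sup>*\<^sup>* k l" using symR rtranclp_trans by metis
        then obtain xs where xs: "xs \<noteq> []" "distinct xs" "hd xs = k" "last xs = l" "set xs \<inter> W = {}"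
          "set (path_edges xs) \<subseteq> E" using reachable_path[of E W k l] K[of k] kl(1) unfolding R_def by blast
        have "path_edges (a # xs @ [b]) = {a,k} # path_edges (xs @ [b])"
          using xs(1,3) by (cases xs) auto
        moreover have "path_edges (xs @ [b]) = path_edges xs @ [{l,b}]"
          using path_edges_split[of "butlast xs" l "[b]"] append_butlast_last_id[OF xs(1)] xs(4)
          by simp (metis append.assoc append_Cons append_Nil)
        ultimately have P: "set (path_edges (a # xs @ [b])) \<subseteq> E"
          "set (path_edges (a # xs @ [b])) = insert {a,k} (insert {l,b} (set (path_edges xs)))"
          using xs(6) kl by (auto simp: insert_commute)
        have "e \<notin> F" if "e \<in> set (path_edges (a # xs @ [b]))" for e
        proof -
          have "\<exists>x\<in>e. x \<notin> W"
          proof (cases "e \<in> set (path_edges xs)")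
            case True
            then have "card e = 2" using xs(6) G(1) by (auto simp: graph_def)
            then have "e \<noteq> {}" by auto
            then show ?thesis using path_edges_subset[OF True] xs(5) by blast
          next
            case False
            then have "e = {a,k} \<or> e = {l,b}" using that P(2) by simp
            then show ?thesis using K[of k] K[of l] kl by auto
          qed
          then show ?thesis using WF(2) by blast
        qed
        then show False using no_ear[OF kl(5,6) ne xs(2,5) P(1)] by blast
      qed
      moreover have "finite N" using WF(4) by (simp add: N_def)
      ultimately show ?thesis using card_le_Suc0_iff_eq by blast
    qed
    moreover have "N \<subseteq> W" by (auto simp: N_def)
    moreover have "\<forall>e\<in>E. e \<subseteq> K \<union> N \<or> e \<subseteq> V - K"
    proof
      fix e assume e: "e \<in> E"
      show "e \<subseteq> K \<union> N \<or> e \<subseteq> V - K"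
      proof (cases "e \<inter> K = {}")
        case True then show ?thesis using EV[OF e] by blast
      next
        case False
        then obtain k where k: "k \<in> K" "k \<in> e" by blast
        obtain y where y: "e = {k,y}" using graph_edge[OF G(1) e k(2)] by blast
        have "y \<in> K \<or> y \<in> N" using Kstep[OF k(1), of y] k(1) KW e unfolding y N_def by blast
        then show ?thesis using k y by blast
      qed
    qed
    \<comment> \<open>\<open>W\<close> contains a cycle and so has at least three vertices, while
      \<open>N\<close> has at most one. Hence \<open>K \<union> N\<close> is a proper part.\<close>
    moreover have "\<not> W \<subseteq> K \<union> N"
    proof
      assume "W \<subseteq> K \<union> N"
      then have "W \<subseteq> N" using KW by blast
      then have "card W \<le> card N" using WF(4) \<open>N \<subseteq> W\<close> by (intro card_mono) (auto intro: finite_subset)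
      then show False using WF(5) \<open>card N \<le> Suc 0\<close> by simp
    qed
    moreover have "(K \<union> N) \<inter> (V - K) = N" "K \<union> N \<union> (V - K) = V"
      using \<open>N \<subseteq> W\<close> KW KV WV by blast+
    moreover have "K \<union> N \<noteq> V" using \<open>\<not> W \<subseteq> K \<union> N\<close> WV by blast
    moreover have "V - K \<noteq> V" using uK u by blast
    ultimately have "one_separable V E"
      unfolding one_separable_def by (intro exI[of _ "K \<union> N"] exI[of _ "V - K"]) simp
    then show False using ns by simp
  qed
  have "F = E"
  proof (rule ccontr)
    assume "F \<noteq> E"
    then obtain e where e: "e \<in> E" "e \<notin> F" using WF by blast
    have "card e = 2" using G(1) e by (auto simp: graph_def)
    then obtain a b where "e = {a,b}" "a \<noteq> b" by (auto simp: card_2_iff)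
    then show False using no_ear[of a b "[]"] e EV[OF e(1)] W by auto
  qed
  then show ?thesis using eb W by simp
qed

text \<open>If the graph splits, the bounds for the two parts give 2m + 6 <= 3(n + 1). Otherwise
  \<open>ear_built_edge_bound\<close> with g = 6 gives even 2m + 6 <= 3n, except for one or two
  vertices, which are checked directly.\<close>

lemma planar_girth_6_edge_bound:
  assumes "graph V E" "planar V E" "V \<noteq> {}" "\<And>cs. is_cycle V E cs \<Longrightarrow> 6 \<le> length cs"
  shows "2 * card E + 3 \<le> 3 * card V"
  using assms
proof (induction "card V" arbitrary: V E rule: less_induct)
  case less
  note G = less.prems(1) and planar = less.prems(2) and girth = less.prems(4)
  have fin: "finite V" "finite E" using G graph_finite_edges by (auto simp: graph_def)
  have EV: "e \<subseteq> V" "card e = 2" if "e \<in> E" for e using G that by (auto simp: graph_def)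
  show ?case
  proof (cases "one_separable V E")
    case True
    then obtain A B where AB: "A \<union> B = V" "A \<noteq> V" "B \<noteq> V" "card (A \<inter> B) \<le> 1"
      "\<forall>e\<in>E. e \<subseteq> A \<or> e \<subseteq> B" unfolding one_separable_def by blast
    have part: "2 * card {e \<in> E. e \<subseteq> X} + 3 \<le> 3 * card X" if X: "X \<subset> V" "X \<noteq> {}" for X
    proof (rule less.hyps)
      show "card X < card V" using X fin by (simp add: psubset_card_mono)
      show "graph X {e \<in> E. e \<subseteq> X}" using X by (intro graph_subgraph[OF G]) auto
      show "planar X {e \<in> E. e \<subseteq> X}" using X by (intro planar_subgraph[OF G planar]) auto
      show "6 \<le> length cs" if "is_cycle X {e \<in> E. e \<subseteq> X} cs" for cs
        using X by (intro girth is_cycle_mono[OF that]) auto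
    qed fact
    have "A \<subset> V" "B \<subset> V" "A \<noteq> {}" "B \<noteq> {}" using AB by auto
    then have "2 * card {e \<in> E. e \<subseteq> A} + 3 \<le> 3 * card A" "2 * card {e \<in> E. e \<subseteq> B} + 3 \<le> 3 * card B"
      using part by auto
    moreover have "card E \<le> card {e \<in> E. e \<subseteq> A} + card {e \<in> E. e \<subseteq> B}"
    proof -
      have "E = {e \<in> E. e \<subseteq> A} \<union> {e \<in> E. e \<subseteq> B}" using AB by blast
      then show ?thesis by (metis card_Un_le)
    qed
    moreover have "card A + card B = card V + card (A \<inter> B)"
      using AB(1) fin card_Un_Int[of A B] by (metis finite_Un)
    ultimately show ?thesis using AB(4) by linarith
  next
    case False
    show ?thesis
    proof (cases "card V \<ge> 3")
      case True
      obtain f \<gamma> where "drawing V E f \<gamma>" using planar_imp_drawing[OF G planar] by blast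
      then interpret drawing V E f \<gamma> .
      have "6 * (card E + 2) \<le> 2 * card E + 6 * card V"
        using ear_built_edge_bound[OF ear_built_of_not_separable[OF G True False]] girth by blast
      then show ?thesis by (simp add: algebra_simps)
    next
      case F: False
      \<comment> \<open>With at most two vertices, an edge can only be the whole vertex set.\<close>
      have "E \<subseteq> {V}"
      proof
        fix e assume "e \<in> E"
        then have "e \<subseteq> V" "card e = 2" using EV by auto
        then show "e \<in> {V}" using F fin card_seteq[of V e] by simp
      qed
      then have cE: "card E \<le> 1" using card_mono[of "{V}" E] by simp
      have "card V > 0" using fin less.prems(3) by (simp add: card_gt_0_iff)
      moreover have "E = {}" if "card V = 1" using \<open>E \<subseteq> {V}\<close> EV(2) that by fastforce
      ultimately show ?thesis using cE F by (cases "card V = 1") auto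
    qed
  qed
qed

lemma sum_degree:
  assumes "graph V E"
  shows "(\<Sum>v\<in>V. degree E v) = 2 * card E"
proof -
  have "finite V" "finite E" "\<And>e. e \<in> E \<Longrightarrow> e \<subseteq> V \<and> card e = 2"
    using assms graph_finite_edges by (auto simp: graph_def)
  moreover from this have "card {v \<in> V. v \<in> e} = 2" if "e \<in> E" for e
    using that by (metis (no_types, lifting) Collect_mem_eq Collect_cong subsetD)
  ultimately show ?thesis
    unfolding degree_def using sum_multicount[of V E "\<lambda>v e. v \<in> e" 2] by simp
qed

lemma planar_girth_6_small_degree:
  assumes "graph V E" "planar V E" "V \<noteq> {}" "\<And>cs. is_cycle V E cs \<Longrightarrow> 6 \<le> length cs"
  shows "\<exists>v\<in>V. degree E v \<le> 2"
proof (rule ccontr)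
  assume "\<not> ?thesis"
  then have "(\<Sum>v\<in>V. 3) \<le> (\<Sum>v\<in>V. degree E v)" by (intro sum_mono) force
  then have "3 * card V \<le> 2 * card E" using sum_degree[OF assms(1)] by simp
  then show False using planar_girth_6_edge_bound[OF assms] by simp
qed

section \<open>Subdivision and suppression\<close>

lemma drawing_add_vertex:
  assumes "drawing V E f \<gamma>" "x \<notin> V" "m \<notin> f ` V" "\<And>e. e \<in> E \<Longrightarrow> m \<notin> path_image (\<gamma> e)"
  shows "drawing (insert x V) E (f(x := m)) \<gamma>"
proof -
  interpret drawing V E f \<gamma> by fact
  have f: "(f(x := m)) ` A = f ` A" if "A \<subseteq> V" for A
    using that assms(2) by (intro image_cong) auto
  have fV: "(f(x := m)) ` insert x V = insert m (f ` V)"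
    using f[of V] by (metis fun_upd_same image_insert order_refl)
  show ?thesis
  proof
    show "inj_on (f(x := m)) (insert x V)"
      using inj assms(2,3) f[of V] by (auto simp: inj_on_fun_updI)
    fix e assume e: "e \<in> E"
    show "e \<subseteq> insert x V" using edge_subset[OF e] by blast
    show "arc (\<gamma> e)" by (rule edge_arc[OF e])
    obtain u v where uv: "e = {u,v}" "pathstart (\<gamma> e) = f u" "pathfinish (\<gamma> e) = f v"
      using edge_ends[OF e] by blast
    then show "\<exists>u v. e = {u, v} \<and> pathstart (\<gamma> e) = (f(x := m)) u \<and> pathfinish (\<gamma> e) = (f(x := m)) v"
      using edge_subset[OF e] assms(2) by (intro exI[of _ u] exI[of _ v]) auto
    show "path_image (\<gamma> e) \<inter> (f(x := m)) ` insert x V = (f(x := m)) ` e"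
      unfolding fV f[OF edge_subset[OF e]] using edge_vertices[OF e] assms(4)[OF e] by blast
    fix e' assume e': "e' \<in> E" "e \<noteq> e'"
    have "e \<inter> e' \<subseteq> V" using edge_subset[OF e] by blast
    then show "path_image (\<gamma> e) \<inter> path_image (\<gamma> e') \<subseteq> (f(x := m)) ` (e \<inter> e')"
      using edge_meet[OF e e'] f by simp
  qed
qed

lemma drawing_add_edge:
  assumes "drawing V E f \<gamma>" "a \<in> V" "b \<in> V" "{a,b} \<notin> E"
    and g: "arc g" "pathstart g = f a" "pathfinish g = f b" "path_image g \<inter> f ` V = {f a, f b}"
    and meet: "\<And>e. e \<in> E \<Longrightarrow> path_image g \<inter> path_image (\<gamma> e) \<subseteq> f ` ({a,b} \<inter> e)"
  shows "drawing V (insert {a,b} E) f (\<gamma>({a,b} := g))"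
proof -
  interpret drawing V E f \<gamma> by fact
  have old: "(\<gamma>({a,b} := g)) e = \<gamma> e" if "e \<in> E" for e using that assms(4) by auto
  show ?thesis
  proof
    show "inj_on f V" by (rule inj)
    fix e assume e: "e \<in> insert {a,b} E"
    show "e \<subseteq> V" using e edge_subset assms(2,3) by auto
    show "arc ((\<gamma>({a,b} := g)) e)" using e edge_arc g old by (cases "e = {a,b}") auto
    show "\<exists>u v. e = {u, v} \<and> pathstart ((\<gamma>({a,b} := g)) e) = f u \<and> pathfinish ((\<gamma>({a,b} := g)) e) = f v"
    proof (cases "e = {a,b}")
      case True then show ?thesis using g by (intro exI[of _ a] exI[of _ b]) simp
    next
      case False then show ?thesis using e old edge_ends by simp
    qed
    show "path_image ((\<gamma>({a,b} := g)) e) \<inter> f ` V = f ` e"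
      using e edge_vertices g old by (cases "e = {a,b}") auto
    fix e' assume e': "e' \<in> insert {a,b} E" "e \<noteq> e'"
    show "path_image ((\<gamma>({a,b} := g)) e) \<inter> path_image ((\<gamma>({a,b} := g)) e') \<subseteq> f ` (e \<inter> e')"
    proof (cases "e = {a,b}")
      case True
      then show ?thesis using e' meet[of e'] old[of e'] by simp
    next
      case False
      then have E: "e \<in> E" using e by simp
      show ?thesis
      proof (cases "e' = {a,b}")
        case True
        then show ?thesis using meet[OF E] old[OF E] by (simp add: Int_commute)
      next
        case False
        then show ?thesis using e' edge_meet[OF E] old E by simp
      qed
    qed
  qed
qed

text \<open>Read backwards it describes the suppression of \<open>x\<close>, so the same lemmas
  serve both halves of the theorem.\<close>

definition subdivide :: "'a set set \<Rightarrow> 'a \<Rightarrow> 'a \<Rightarrow> 'a \<Rightarrow> 'a set set" where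
  "subdivide E a x b = insert {a,x} (insert {x,b} (E - {{a,b}}))"

lemma arc_bisect:
  fixes g :: "real \<Rightarrow> complex"
  assumes "arc g"
  obtains g1 g2 m where "arc g1" "arc g2" "pathstart g1 = pathstart g" "pathfinish g1 = m"
    "pathstart g2 = m" "pathfinish g2 = pathfinish g" "path_image g1 \<union> path_image g2 = path_image g"
    "path_image g1 \<inter> path_image g2 = {m}" "m \<noteq> pathstart g" "m \<noteq> pathfinish g"
proof (rule that[of "subpath 0 (1/2) g" "subpath (1/2) 1 g" "g (1/2)"])
  have inj: "inj_on g {0..1}" using assms by (simp add: arc_def)
  show "arc (subpath 0 (1/2) g)" "arc (subpath (1/2) 1 g)" using assms by (auto intro: arc_subpath_arc)
  show "pathstart (subpath 0 (1/2) g) = pathstart g" "pathfinish (subpath 0 (1/2) g) = g (1/2)"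
    "pathstart (subpath (1/2) 1 g) = g (1/2)" "pathfinish (subpath (1/2) 1 g) = pathfinish g"
    by (simp_all add: pathstart_def pathfinish_def subpath_def)
  have im: "path_image (subpath 0 (1/2) g) = g ` {0..1/2}" "path_image (subpath (1/2) 1 g) = g ` {1/2..1}"
    by (simp_all add: path_image_subpath)
  have "{0..1/2} \<union> {1/2..1} = {0..1::real}" "{0..1/2} \<inter> {1/2..1} = {1/2::real}" by auto
  then show "path_image (subpath 0 (1/2) g) \<union> path_image (subpath (1/2) 1 g) = path_image g"
    "path_image (subpath 0 (1/2) g) \<inter> path_image (subpath (1/2) 1 g) = {g (1/2)}"
    using inj_on_image_Int[OF inj, of "{0..1/2}" "{1/2..1}"] unfolding im path_image_def[of g]
    by (simp_all flip: image_Un)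
  show "g (1/2) \<noteq> pathstart g" "g (1/2) \<noteq> pathfinish g"
    using inj_onD[OF inj, of "1/2" 0] inj_onD[OF inj, of "1/2" 1] by (auto simp: pathstart_def pathfinish_def)
qed

text \<open>The new vertex is placed at an inner point \<open>m\<close> of the arc of the divided
  edge. No other edge contains \<open>m\<close>, since the others meet this arc at most in its
  ends.\<close>

lemma planar_subdivide:
  assumes G: "graph V E" and pl: "planar V E" and ab: "{a,b} \<in> E" "a \<noteq> b" and x: "x \<notin> V"
  shows "planar (insert x V) (subdivide E a x b)"
proof -
  obtain f \<gamma> where "drawing V E f \<gamma>" using planar_imp_drawing[OF G pl] by blast
  then interpret drawing V E f \<gamma> .
  let ?E0 = "E - {{a,b}}"
  obtain g where g: "arc g" "pathstart g = f a" "pathfinish g = f b" "path_image g = path_image (\<gamma> {a,b})"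
    using edge_oriented[OF ab(1)] .
  obtain g1 g2 m where h: "arc g1" "arc g2" "pathstart g1 = f a" "pathfinish g1 = m"
    "pathstart g2 = m" "pathfinish g2 = f b" "path_image g1 \<union> path_image g2 = path_image g"
    "path_image g1 \<inter> path_image g2 = {m}" "m \<noteq> f a" "m \<noteq> f b"
    using arc_bisect[OF g(1)] unfolding g by metis
  have abV: "a \<in> V" "b \<in> V" using edge_subset[OF ab(1)] by auto
  have gV: "path_image g \<inter> f ` V = {f a, f b}" using edge_vertices[OF ab(1)] g(4) by simp
  have m: "m \<in> path_image g" using h(7,8) by blast
  have mV: "m \<notin> f ` V" using m gV h(9,10) by blast
  have meet: "path_image g \<inter> path_image (\<gamma> e) \<subseteq> f ` ({a,b} \<inter> e)" if "e \<in> ?E0" for e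
    using edge_meet[OF ab(1), of e] that g(4) by auto
  have me: "m \<notin> path_image (\<gamma> e)" if "e \<in> ?E0" for e
    using meet[OF that] m h(9,10) by blast
  have g12: "f a \<in> path_image g1" "f b \<in> path_image g2"
    using h(3,6) by (metis pathstart_in_path_image pathfinish_in_path_image)+
  then have nin: "f b \<notin> path_image g1" "f a \<notin> path_image g2" using h(8-10) by (metis IntI singletonD)+
  have m12: "m \<in> path_image g1" "m \<in> path_image g2" using h(8) by auto
  have sub: "path_image g1 \<subseteq> path_image g" "path_image g2 \<subseteq> path_image g" using h(7) by auto
  have gV12: "path_image g1 \<inter> f ` V = {f a}" "path_image g2 \<inter> f ` V = {f b}"
  proof -
    have "path_image g1 \<inter> f ` V = path_image g1 \<inter> {f a, f b}"
      "path_image g2 \<inter> f ` V = path_image g2 \<inter> {f a, f b}"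
      unfolding gV[symmetric] using sub by (simp_all add: Int_absorb2 flip: Int_assoc)
    then show "path_image g1 \<inter> f ` V = {f a}" "path_image g2 \<inter> f ` V = {f b}"
      using nin g12 by simp_all
  qed
  let ?f = "f(x := m)"
  have fs: "?f a = f a" "?f b = f b" "?f x = m" "a \<noteq> x" "b \<noteq> x" using abV x by auto
  have fV: "?f ` insert x V = insert m (f ` V)" using x by (auto simp: image_iff)
  have xE: "x \<notin> e" if "e \<in> ?E0" for e using that edge_subset x by blast
  have fe: "?f ` (A \<inter> e) = f ` (A \<inter> e)" if "e \<in> ?E0" for e A
    using xE[OF that] by (intro image_cong) auto
  have "drawing V ?E0 f \<gamma>" by (rule subdrawing) (use edge_subset in auto)
  then have d0: "drawing (insert x V) ?E0 ?f \<gamma>"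
    by (rule drawing_add_vertex[OF _ x mV]) (use me in simp)
  have "drawing (insert x V) (insert {x,b} ?E0) ?f (\<gamma>({x,b} := g2))"
  proof (rule drawing_add_edge[OF d0])
    show "{x,b} \<notin> ?E0" using xE by blast
    show "path_image g2 \<inter> ?f ` insert x V = {?f x, ?f b}"
      unfolding fV fs Int_insert_right using gV12 m12 by (simp add: insert_commute)
    fix e assume e: "e \<in> ?E0"
    have "path_image g2 \<inter> path_image (\<gamma> e) \<subseteq> f ` ({x,b} \<inter> e)"
      using meet[OF e] sub(2) nin(2) by blast
    then show "path_image g2 \<inter> path_image (\<gamma> e) \<subseteq> ?f ` ({x,b} \<inter> e)" using fe[OF e] by simp
  qed (use abV h fs in auto)
  then have "drawing (insert x V) (insert {a,x} (insert {x,b} ?E0)) ?f ((\<gamma>({x,b} := g2))({a,x} := g1))"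
  proof (rule drawing_add_edge)
    have "{a,x} \<noteq> {x,b}" using ab(2) fs by (auto simp: doubleton_eq_iff)
    then show "{a,x} \<notin> insert {x,b} ?E0" using xE by blast
    show "path_image g1 \<inter> ?f ` insert x V = {?f a, ?f x}"
      unfolding fV fs Int_insert_right using gV12 m12 by (simp add: insert_commute)
    fix e assume e: "e \<in> insert {x,b} ?E0"
    show "path_image g1 \<inter> path_image ((\<gamma>({x,b} := g2)) e) \<subseteq> ?f ` ({a,x} \<inter> e)"
    proof (cases "e = {x,b}")
      case True
      then show ?thesis using h(8) fs by auto
    next
      case False
      then have e: "e \<in> ?E0" using e by blast
      have "path_image g1 \<inter> path_image (\<gamma> e) \<subseteq> f ` ({a,x} \<inter> e)"
        using meet[OF e] sub(1) nin(1) by blast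
      then show ?thesis using fe[OF e] False by simp
    qed
  qed (use abV h fs in auto)
  then show ?thesis unfolding subdivide_def by (rule drawing.planar)
qed

lemma graph_subdivide:
  assumes "graph V E" "{a,b} \<in> E" "a \<noteq> b" "x \<notin> V"
  shows "graph (insert x V) (subdivide E a x b)"
proof -
  have "{a,b} \<subseteq> V" using assms(1,2) unfolding graph_def by blast
  then have "a \<in> V" "b \<in> V" by auto
  then have "a \<noteq> x" "b \<noteq> x" using assms(4) by auto
  then have "card {a,x} = 2" "card {x,b} = 2" by simp_all
  moreover have "e \<subseteq> insert x V \<and> card e = 2" if "e \<in> E" for e using assms(1) that by (auto simp: graph_def)
  ultimately show ?thesis
    using assms(1) \<open>a \<in> V\<close> \<open>b \<in> V\<close> unfolding graph_def subdivide_def by simp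
qed

text \<open>The two arcs at \<open>x\<close> are joined to a single arc for \<open>{a,b}\<close>,
  and \<open>x\<close> is forgotten.\<close>

lemma planar_of_subdivide:
  assumes G: "graph V E" and pl: "planar (insert x V) (subdivide E a x b)"
    and ab: "{a,b} \<in> E" "a \<noteq> b" and x: "x \<notin> V"
  shows "planar V E"
proof -
  let ?E' = "subdivide E a x b" and ?E0 = "E - {{a,b}}"
  obtain f \<gamma> where "drawing (insert x V) ?E' f \<gamma>"
    using planar_imp_drawing[OF graph_subdivide[OF G ab x] pl] by blast
  then interpret drawing "insert x V" ?E' f \<gamma> .
  have EV: "e \<subseteq> V" if "e \<in> E" for e using that G by (simp add: graph_def)
  have abV: "a \<in> V" "b \<in> V" "a \<noteq> x" "b \<noteq> x" using EV[OF ab(1)] x by auto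
  let ?P = "set (path_edges (a # [x] @ [b]))"
  have P: "?P = {{a,x},{x,b}}" "\<Union>?P = {a,x,b}" by auto
  have PE: "?P \<subseteq> ?E'" by (auto simp: subdivide_def)
  have d: "distinct (a # [x] @ [b])" using abV ab by auto
  obtain g where g: "arc g" "pathstart g = f a" "pathfinish g = f b" "path_image g = draw ?P"
    using path_arc'[OF d PE] .
  have E0: "?E0 \<subseteq> ?E'" by (auto simp: subdivide_def)
  have d0: "drawing V ?E0 f \<gamma>" by (rule subdrawing[OF _ E0]) (use EV in auto)
  have "drawing V (insert {a,b} ?E0) f (\<gamma>({a,b} := g))"
  proof (rule drawing_add_edge[OF d0 abV(1,2) _ g(1-3)])
    have "v \<in> {a,b}" if "v \<in> V" "f v \<in> draw ?P" for v
    proof -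
      have "v \<in> {a,x,b}" using vertex_on_draw[OF PE _ that(2)] that(1) unfolding P(2) by blast
      then show ?thesis using that(1) x by blast
    qed
    then have "path_image g \<inter> f ` V \<subseteq> {f a, f b}" unfolding g(4) by blast
    moreover have "f a \<in> path_image g" "f b \<in> path_image g"
      using g(2,3) by (metis pathstart_in_path_image pathfinish_in_path_image)+
    ultimately show "path_image g \<inter> f ` V = {f a, f b}" using abV by blast
    fix e assume e: "e \<in> ?E0"
    then have xe: "x \<notin> e" using EV x by blast
    then have "?P \<inter> {e} = {}" by auto
    then have "draw ?P \<inter> draw {e} \<subseteq> f ` (\<Union>?P \<inter> \<Union>{e})"
      using e E0 by (intro draw_disjoint[OF PE]) auto
    then show "path_image g \<inter> path_image (\<gamma> e) \<subseteq> f ` ({a,b} \<inter> e)"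
      unfolding g(4) P(2) using xe by (auto simp: draw_def)
  qed simp
  moreover have "insert {a,b} ?E0 = E" using ab by blast
  ultimately show ?thesis using drawing.planar by metis
qed

section \<open>Weights of cycles and ears under subdivision\<close>

lemma path_edges_snoc: "xs \<noteq> [] \<Longrightarrow> path_edges (xs @ [y]) = path_edges xs @ [{last xs, y}]"
  by (induction xs rule: path_edges.induct) auto

lemma cycle_edges_Cons_snoc: "xs \<noteq> [] \<Longrightarrow> cycle_edges (x # xs) = {x, hd xs} # path_edges xs @ [{last xs, x}]"
  using path_edges_snoc[of "x # xs" x] by (cases xs) (simp_all add: cycle_edges_def)

lemma cycle_edges_closing: "cs \<noteq> [] \<Longrightarrow> cycle_edges cs = path_edges cs @ [{last cs, hd cs}]"
  by (simp add: cycle_edges_def path_edges_snoc)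

text \<open>Once the divided edge is the closing one, putting \<open>x\<close> in front of the list
  of vertices subdivides it.\<close>

lemma rotate_to_closing_edge:
  assumes "e \<in> set (cycle_edges cs)"
  obtains u v where "cs = u @ v" "e = {last (v @ u), hd (v @ u)}"
proof -
  have ne: "cs \<noteq> []" using assms by (auto simp: cycle_edges_def)
  then obtain i where i: "i < length cs" "e = {cs ! i, cs ! ((i + 1) mod length cs)}"
    using assms set_cycle_edges_nth[OF ne] by blast
  have u: "take (Suc i) cs \<noteq> []" "last (take (Suc i) cs) = cs ! i"
    using i(1) by (auto simp: take_Suc_conv_app_nth)
  have "hd (drop (Suc i) cs @ take (Suc i) cs) = cs ! ((i + 1) mod length cs)"
  proof (cases "Suc i = length cs")
    case True then show ?thesis using ne by (simp add: hd_conv_nth)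
  next
    case False then show ?thesis using i(1) by (simp add: hd_drop_conv_nth hd_append)
  qed
  then show thesis
    using that[of "take (Suc i) cs" "drop (Suc i) cs"] i(2) u by simp
qed

abbreviation weight :: "('a set \<Rightarrow> nat) \<Rightarrow> 'a set list \<Rightarrow> nat" where
  "weight w es \<equiv> sum_list (map w es)"

lemma weight_mset: "mset es = mset es' \<Longrightarrow> weight w es = weight w es'"
  by (metis mset_map sum_mset_sum_list)

lemma weight_cong: "(\<And>e. e \<in> set es \<Longrightarrow> w e = w' e) \<Longrightarrow> weight w es = weight w' es"
  by (metis map_cong)

lemma internal_vertices_distinct:
  assumes "distinct xs" "length xs \<ge> 2"
  shows "internal_vertices xs = set xs - {hd xs, last xs}"
proof -
  obtain y ys where xs: "xs = y # ys" "ys \<noteq> []" using assms(2) by (cases xs) (auto simp: Suc_le_eq)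
  have "ys = butlast ys @ [last ys]" using xs by simp
  then obtain zs z where ys: "ys = zs @ [z]" by blast
  show ?thesis using assms(1) unfolding xs ys internal_vertices_def by auto
qed

text \<open>Only the sum of the two new weights is fixed. For suppression \<open>w'\<close> is given
  and \<open>w\<close> is defined from it; for the dodecahedron \<open>w\<close> is given and
  \<open>w'\<close> distributes it.\<close>

locale subdivided =
  fixes V :: "'a set" and E :: "'a set set" and a x b :: 'a
    and w w' :: "'a set \<Rightarrow> nat"
  assumes G: "graph V E" and ab: "{a,b} \<in> E" "a \<noteq> b" and x: "x \<notin> V"
    and w_old: "\<And>e. e \<in> E \<Longrightarrow> e \<noteq> {a,b} \<Longrightarrow> w' e = w e"
    and w_new: "w' {a,x} + w' {x,b} = w {a,b}"
begin

abbreviation "V' \<equiv> insert x V"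
abbreviation "E' \<equiv> subdivide E a x b"

lemma edge_subset: "e \<in> E \<Longrightarrow> e \<subseteq> V" using G by (simp add: graph_def)
lemma no_x: "e \<in> E \<Longrightarrow> x \<notin> e" using edge_subset x by blast
lemma abV: "a \<in> V" "b \<in> V" "a \<noteq> x" "b \<noteq> x" using edge_subset[OF ab(1)] x by auto
lemma ab_notin: "{a,b} \<notin> E'" using abV ab(2) by (auto simp: subdivide_def doubleton_eq_iff)
lemma new_ne: "{a,x} \<noteq> {x,b}" using abV ab(2) by (auto simp: doubleton_eq_iff)
lemma new_notin: "{a,x} \<notin> E" "{x,b} \<notin> E" using no_x by blast+
lemma E'_old: "e \<in> E' \<Longrightarrow> x \<notin> e \<Longrightarrow> e \<in> E \<and> e \<noteq> {a,b}" by (auto simp: subdivide_def)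
lemma old_E': "e \<in> E \<Longrightarrow> e \<noteq> {a,b} \<Longrightarrow> e \<in> E'" by (auto simp: subdivide_def)
lemma edge_at_x: "{x,c} \<in> E' \<Longrightarrow> c = a \<or> c = b"
  using no_x[of "{x,c}"] by (auto simp: subdivide_def doubleton_eq_iff)

text \<open>Stated for arbitrary \<open>h\<close> because it serves three sums: degrees, the weight
  of a label class, and the termination measure of repeated subdivision.\<close>

lemma sum_subdivide:
  fixes h h' :: "'a set \<Rightarrow> nat"
  assumes "\<And>e. e \<in> E \<Longrightarrow> e \<noteq> {a,b} \<Longrightarrow> h' e = h e"
  shows "(\<Sum>e\<in>E'. h' e) + h {a,b} = (\<Sum>e\<in>E. h e) + h' {a,x} + h' {x,b}"
proof -
  have fin: "finite (E - {{a,b}})" using graph_finite_edges[OF G] by simp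
  have "(\<Sum>e\<in>E'. h' e) = h' {a,x} + (h' {x,b} + (\<Sum>e\<in>E - {{a,b}}. h' e))"
    using fin new_ne new_notin by (simp add: subdivide_def)
  moreover have "(\<Sum>e\<in>E - {{a,b}}. h' e) = (\<Sum>e\<in>E - {{a,b}}. h e)"
    using assms by (intro sum.cong) auto
  moreover have "(\<Sum>e\<in>E. h e) = h {a,b} + (\<Sum>e\<in>E - {{a,b}}. h e)"
    using graph_finite_edges[OF G] ab(1) by (rule sum.remove)
  ultimately show ?thesis by simp
qed

lemma degree_sum: "graph U F \<Longrightarrow> degree F v = (\<Sum>e\<in>F. of_bool (v \<in> e))"
  using graph_finite_edges[of U F] by (simp add: degree_def Int_def)

lemma degree_old:
  assumes "v \<in> V" shows "degree E' v = degree E v"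
proof -
  have "v \<noteq> x" using assms x by auto
  then have "(of_bool (v \<in> {a,x}) :: nat) + of_bool (v \<in> {x,b}) = of_bool (v \<in> {a,b})"
    using ab(2) by auto
  then show ?thesis
    using sum_subdivide[of "\<lambda>e. of_bool (v \<in> e)" "\<lambda>e. of_bool (v \<in> e)"]
      degree_sum[OF G] degree_sum[OF graph_subdivide[OF G ab x]] by simp
qed

lemma edges_at_x: "{e \<in> E'. x \<in> e} = {{a,x}, {x,b}}"
  using no_x by (auto simp: subdivide_def)

lemma degree_x: "degree E' x = 2"
  unfolding degree_def edges_at_x using new_ne by simp

text \<open>Carries a lower bound on cycle weights to the suppressed graph, and a cycle of a given
  weight to the subdivided one.\<close>

lemma cycle_lift:
  assumes cs: "is_cycle V E cs"
  shows "\<exists>cs'. is_cycle V' E' cs' \<and> weight w' (cycle_edges cs') = weight w (cycle_edges cs)"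
proof (cases "{a,b} \<in> set (cycle_edges cs)")
  case False
  then have "weight w' (cycle_edges cs) = weight w (cycle_edges cs)"
    using cs w_old by (intro weight_cong) (auto simp: is_cycle_iff)
  moreover have "is_cycle V' E' cs" using cs False old_E' by (auto simp: is_cycle_iff)
  ultimately show ?thesis by blast
next
  case True
  then obtain u v where uv: "cs = u @ v" "{a,b} = {last (v @ u), hd (v @ u)}"
    by (rule rotate_to_closing_edge)
  define ds where "ds = v @ u"
  have ds: "is_cycle V E ds" "{a,b} = {last ds, hd ds}"
    using is_cycle_rotate[of V E u v] cs uv unfolding ds_def by auto
  have wds: "weight w (cycle_edges cs) = weight w (cycle_edges ds)"
    using mset_cycle_edges_rotate[of u v] unfolding uv(1) ds_def by (rule weight_mset)
  have ne: "ds \<noteq> []" and d: "distinct ds" "length ds \<ge> 3" "set ds \<subseteq> V" "set (cycle_edges ds) \<subseteq> E"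
    using ds(1) by (auto simp: is_cycle_iff)
  have "{a,b} \<notin> set (path_edges ds)"
    using distinct_cycle_edges[OF d(1,2)] ds(2) unfolding cycle_edges_closing[OF ne] by simp
  then have pe: "e \<in> E \<and> e \<noteq> {a,b}" if "e \<in> set (path_edges ds)" for e
    using that d(4) unfolding cycle_edges_closing[OF ne] by auto
  have lh: "last ds = a \<and> hd ds = b \<or> last ds = b \<and> hd ds = a"
    using ds(2) by (auto simp: doubleton_eq_iff)
  have new: "{x, hd ds} \<in> E'" "{last ds, x} \<in> E'" "w' {x, hd ds} + w' {last ds, x} = w {last ds, hd ds}"
    using lh w_new by (auto simp: subdivide_def insert_commute)
  have "is_cycle V' E' (x # ds)"
    using d x new pe old_E' unfolding is_cycle_iff cycle_edges_Cons_snoc[OF ne] by auto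
  moreover have "weight w' (path_edges ds) = weight w (path_edges ds)"
    using pe w_old by (intro weight_cong) auto
  then have "weight w' (cycle_edges (x # ds)) = weight w (cycle_edges ds)"
    unfolding cycle_edges_Cons_snoc[OF ne] cycle_edges_closing[OF ne] using new(3) by simp
  ultimately show ?thesis using wds by metis
qed

text \<open>Carries a lower bound on cycle weights to the subdivided graph. A cycle through
  \<open>x\<close> uses both edges there, so leaving out \<open>x\<close> closes it by
  \<open>{a,b}\<close>.\<close>

lemma cycle_project:
  assumes cs: "is_cycle V' E' cs"
  shows "\<exists>cs'. is_cycle V E cs' \<and> weight w (cycle_edges cs') = weight w' (cycle_edges cs)"
proof (cases "x \<in> set cs")
  case False
  have "cs \<noteq> []" using cs by (auto simp: is_cycle_iff)
  have old: "e \<in> E \<and> e \<noteq> {a,b}" if "e \<in> set (cycle_edges cs)" for e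
    using that cs False Union_cycle_edges[OF \<open>cs \<noteq> []\<close>] by (intro E'_old) (auto simp: is_cycle_iff)
  then have "weight w (cycle_edges cs) = weight w' (cycle_edges cs)"
    using w_old by (intro weight_cong) auto
  moreover have "is_cycle V E cs" using cs old False by (auto simp: is_cycle_iff)
  ultimately show ?thesis by blast
next
  case True
  then obtain u v where uv: "cs = u @ x # v" by (meson split_list)
  define ds where "ds = v @ u"
  have c: "is_cycle V' E' (x # ds)"
    using is_cycle_rotate[of V' E' u "x # v"] cs unfolding uv ds_def by simp
  have wds: "weight w' (cycle_edges cs) = weight w' (cycle_edges (x # ds))"
    using mset_cycle_edges_rotate[of u "x # v"] unfolding uv ds_def by (intro weight_mset) simp
  have ne: "ds \<noteq> []" using c by (auto simp: is_cycle_iff)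
  have d: "distinct ds" "length ds \<ge> 2" "x \<notin> set ds" "set ds \<subseteq> V"
    using c by (auto simp: is_cycle_iff)
  have E: "{x, hd ds} \<in> E'" "{last ds, x} \<in> E'" "set (path_edges ds) \<subseteq> E'"
    using c unfolding is_cycle_iff cycle_edges_Cons_snoc[OF ne] by auto
  have "hd ds \<noteq> last ds" using d(1,2) by (cases ds) auto
  moreover have "hd ds = a \<or> hd ds = b" "last ds = a \<or> last ds = b"
    using edge_at_x[of "hd ds"] edge_at_x[of "last ds"] E by (auto simp: insert_commute)
  ultimately have lh: "last ds = a \<and> hd ds = b \<or> last ds = b \<and> hd ds = a" by auto
  then have close: "{last ds, hd ds} = {a,b}" by auto
  have "w' {x, hd ds} + w' {last ds, x} = w {last ds, hd ds}"
    using lh w_new by (auto simp: insert_commute)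
  moreover have pe: "e \<in> E \<and> e \<noteq> {a,b}" if "e \<in> set (path_edges ds)" for e
    using that E(3) d(3) path_edges_subset[OF that] by (intro E'_old) auto
  then have "weight w (path_edges ds) = weight w' (path_edges ds)"
    using w_old by (intro weight_cong) auto
  ultimately have "weight w (cycle_edges ds) = weight w' (cycle_edges (x # ds))"
    unfolding cycle_edges_Cons_snoc[OF ne] cycle_edges_closing[OF ne] by simp
  \<comment> \<open>A triangle through \<open>x\<close> would use \<open>{a,b}\<close>, which is not
    an edge after subdivision; so at least three vertices remain.\<close>
  moreover have "length ds \<noteq> 2"
  proof
    assume "length ds = 2"
    then obtain y z where "ds = [y,z]" by (auto simp: numeral_2_eq_2 length_Suc_conv)
    then have "{a,b} \<in> E'" using E(3) lh by (auto simp: insert_commute)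
    then show False using ab_notin by simp
  qed
  then have "is_cycle V E ds"
    using d pe ab(1) close unfolding is_cycle_iff cycle_edges_closing[OF ne] by auto
  ultimately show ?thesis using wds by metis
qed

text \<open>The inserted vertex has degree 2 and all other degrees are unchanged, so an ear remains
  an ear. Hence suppression cannot create ears that are too heavy.\<close>

lemma path_lift:
  assumes xs: "is_path V E xs" "length xs \<ge> 2" and deg: "\<forall>v\<in>internal_vertices xs. degree E v = 2"
  shows "\<exists>ys. is_path V' E' ys \<and> length ys \<ge> 2 \<and> (\<forall>v\<in>internal_vertices ys. degree E' v = 2) \<and>
    weight w' (path_edges ys) = weight w (path_edges xs)"
proof (cases "{a,b} \<in> set (path_edges xs)")
  case False
  then have "weight w' (path_edges xs) = weight w (path_edges xs)"
    using xs w_old by (intro weight_cong) (auto simp: is_path_iff)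
  moreover have "is_path V' E' xs" using xs False old_E' by (auto simp: is_path_iff)
  moreover have "distinct xs" "set xs \<subseteq> V" using xs(1) by (simp_all add: is_path_iff)
  then have "internal_vertices xs \<subseteq> V" using internal_vertices_distinct[OF _ xs(2)] by blast
  then have "\<forall>v\<in>internal_vertices xs. degree E' v = 2" using deg degree_old by (simp add: subset_iff)
  ultimately show ?thesis using xs(2) by blast
next
  case True
  then obtain i where i: "Suc i < length xs" "{a,b} = {xs ! i, xs ! Suc i}"
    unfolding set_path_edges_nth by blast
  define s t c d where "s = take i xs" and "t = drop (Suc (Suc i)) xs" and "c = xs ! i" and "d = xs ! Suc i"
  have split: "xs = s @ c # drop (Suc i) xs"
    unfolding s_def c_def by (rule id_take_nth_drop[OF Suc_lessD[OF i(1)]])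
  have drop: "drop (Suc i) xs = d # t"
    unfolding d_def t_def by (rule Cons_nth_drop_Suc[OF i(1), symmetric])
  have st: "xs = s @ c # d # t" using split unfolding drop .
  have cd: "c = a \<and> d = b \<or> c = b \<and> d = a"
    using i(2) unfolding c_def[symmetric] d_def[symmetric] doubleton_eq_iff by blast
  let ?ys = "s @ c # x # d # t"
  have dist: "distinct xs" "set xs \<subseteq> V" "set (path_edges xs) \<subseteq> E" using xs(1) by (auto simp: is_path_iff)
  have pxs: "path_edges xs = path_edges (s @ [c]) @ {c,d} # path_edges (d # t)"
    unfolding st path_edges_split[of s c "d # t"] by simp
  have pys: "path_edges ?ys = path_edges (s @ [c]) @ {c,x} # {x,d} # path_edges (d # t)"
    unfolding path_edges_split[of s c "x # d # t"] by simp
  have "distinct (path_edges xs)" using distinct_path_edges[OF dist(1)] .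
  have old: "e \<in> E \<and> e \<noteq> {a,b}" if "e \<in> set (path_edges (s @ [c]) @ path_edges (d # t))" for e
  proof -
    have "{c,d} = {a,b}" by (simp only: i(2) c_def d_def)
    then show ?thesis using that dist(3) \<open>distinct (path_edges xs)\<close> unfolding pxs by auto
  qed
  have new: "{c,x} \<in> E'" "{x,d} \<in> E'" "w' {c,x} + w' {x,d} = w {c,d}"
    using cd w_new by (auto simp: subdivide_def insert_commute)
  have wt: "weight w' (path_edges (s @ [c])) = weight w (path_edges (s @ [c]))"
    "weight w' (path_edges (d # t)) = weight w (path_edges (d # t))"
    by (rule weight_cong, use old w_old in simp)+
  have "set (path_edges ?ys) \<subseteq> E'"
    using new(1,2) old old_E' unfolding pys by (simp add: subset_iff)
  moreover have dy: "distinct ?ys" "set ?ys \<subseteq> V'" using dist x unfolding st by auto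
  ultimately have "is_path V' E' ?ys" by (simp add: is_path_iff)
  moreover have "weight w' (path_edges ?ys) = weight w (path_edges xs)"
    unfolding pxs pys using wt new(3) by simp
  moreover have "degree E' v = 2" if v: "v \<in> internal_vertices ?ys" for v
  proof (cases "v = x")
    case True then show ?thesis by (simp add: degree_x)
  next
    case False
    have hl: "hd ?ys = hd xs" "last ?ys = last xs" "set ?ys = insert x (set xs)" "length ?ys \<ge> 2"
      unfolding st by (auto simp: hd_append)
    have "internal_vertices ?ys = insert x (set xs) - {hd xs, last xs}"
      using internal_vertices_distinct[OF dy(1) hl(4)] unfolding hl .
    then have "v \<in> internal_vertices xs" "v \<in> V"
      using v False dist(2) unfolding internal_vertices_distinct[OF dist(1) xs(2)] by blast+
    then show ?thesis using deg degree_old by simp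
  qed
  ultimately show ?thesis by (intro exI[of _ ?ys]) simp
qed

end

lemma subdivided_of_degree_2:
  assumes G: "graph U F" and v: "x \<in> U" "degree F x = 2"
  obtains a b where "{a,x} \<in> F" "{x,b} \<in> F" "a \<noteq> b" "a \<in> U - {x}" "b \<in> U - {x}"
    "{e \<in> F. x \<in> e} = {{a,x},{x,b}}"
proof -
  obtain e1 e2 where e: "{e \<in> F. x \<in> e} = {e1,e2}" "e1 \<noteq> e2"
    using v(2) unfolding degree_def card_2_iff by blast
  then have e12: "e1 \<in> F" "x \<in> e1" "e2 \<in> F" "x \<in> e2" by blast+
  obtain a where a: "e1 = {x,a}" "a \<noteq> x" "a \<in> U" using graph_edge[OF G e12(1,2)] by metis
  obtain b where b: "e2 = {x,b}" "b \<noteq> x" "b \<in> U" using graph_edge[OF G e12(3,4)] by metis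
  show thesis
    using that[of a b] e e12 a b by (simp add: insert_commute) (metis)
qed

text \<open>The premise \<open>{a,b} \<notin> F\<close> says that the new edge is not parallel to an
  old one; otherwise subdividing would not give back \<open>F\<close>.\<close>

lemma graph_suppress:
  assumes G: "graph U F" and x: "{e \<in> F. x \<in> e} = {{a,x},{x,b}}"
    and ab: "a \<noteq> b" "a \<in> U - {x}" "b \<in> U - {x}" "{a,b} \<notin> F"
  defines "E \<equiv> insert {a,b} {e \<in> F. x \<notin> e}"
  shows "graph (U - {x}) E" "subdivide E a x b = F"
proof -
  have FU: "e \<subseteq> U" "card e = 2" if "e \<in> F" for e using G that by (auto simp: graph_def)
  then show "graph (U - {x}) E"
    using G ab unfolding graph_def E_def by (auto simp: card_2_iff)
  have "E - {{a,b}} = {e \<in> F. x \<notin> e}" using ab(4) unfolding E_def by blast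
  then have "subdivide E a x b = {e \<in> F. x \<in> e} \<union> {e \<in> F. x \<notin> e}" unfolding subdivide_def x by simp
  then show "subdivide E a x b = F" by blast
qed

text \<open>The weight of an edge is the length of the path of the original graph that it replaces.\<close>
lemma planar_weighted_reducible:
  fixes w :: "'a set \<Rightarrow> nat"
  assumes "graph V E" "planar V E" "p \<ge> 1"
    and "\<And>v. v \<in> V \<Longrightarrow> degree E v \<ge> 2"
    and "\<And>cs. is_cycle V E cs \<Longrightarrow> 5 * p \<le> weight w (cycle_edges cs) + 4"
    and "\<And>xs. is_path V E xs \<Longrightarrow> length xs \<ge> 2 \<Longrightarrow> \<forall>v\<in>internal_vertices xs. degree E v = 2 \<Longrightarrow>
      weight w (path_edges xs) < p"
  shows "V = {}"
  using assms
proof (induction "card V" arbitrary: V E w rule: less_induct)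
  case less
  note G = less.prems(1) and pl = less.prems(2) and p = less.prems(3)
    and deg = less.prems(4) and cyc = less.prems(5) and ear = less.prems(6)
  show ?case
  proof (rule ccontr)
    assume ne: "V \<noteq> {}"
    have edge: "w {u,v} < p" if "{u,v} \<in> E" "u \<noteq> v" for u v
    proof -
      have "is_path V E [u,v]" using that G by (auto simp: is_path_iff graph_def)
      then show ?thesis using ear[of "[u,v]"] by (simp add: internal_vertices_def)
    qed
    have "6 \<le> length cs" if cs: "is_cycle V E cs" for cs
    proof (rule ccontr)
      assume "\<not> ?thesis"
      have "w e \<le> p - 1" if "e \<in> set (cycle_edges cs)" for e
      proof -
        have "e \<in> E" using that cs by (auto simp: is_cycle_iff)
        then obtain u v where "e = {u,v}" "u \<noteq> v" using G by (auto simp: graph_def card_2_iff)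
        then show ?thesis using edge[of u v] \<open>e \<in> E\<close> by simp
      qed
      then have "weight w (cycle_edges cs) \<le> weight (\<lambda>_. p - 1) (cycle_edges cs)"
        by (intro sum_list_mono) auto
      also have "\<dots> = length cs * (p - 1)" by (simp add: sum_list_triv length_cycle_edges)
      also have "\<dots> \<le> 5 * (p - 1)" using \<open>\<not> 6 \<le> length cs\<close> by (intro mult_right_mono) auto
      finally show False using cyc[OF cs] p by (simp add: diff_mult_distrib2)
    qed
    then obtain x where x: "x \<in> V" "degree E x \<le> 2"
      using planar_girth_6_small_degree[OF G pl ne] by blast
    then have d2: "degree E x = 2" using deg by (simp add: le_antisym)
    obtain a b where ab: "{a,x} \<in> E" "{x,b} \<in> E" "a \<noteq> b" "a \<in> V - {x}" "b \<in> V - {x}"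
      "{e \<in> E. x \<in> e} = {{a,x},{x,b}}" using subdivided_of_degree_2[OF G x(1) d2] .
    have axb: "w {a,x} + w {x,b} < p"
    proof -
      have "is_path V E [a,x,b]" using ab x(1) by (auto simp: is_path_iff)
      then show ?thesis using ear[of "[a,x,b]"] d2 by (simp add: internal_vertices_def)
    qed
    \<comment> \<open>The ear through \<open>x\<close> and the single edge \<open>{a,b}\<close>,
      itself an ear, weigh at most p - 1 each. Their triangle weighs at most 2p - 2, which is less
      than 5p - 4.\<close>
    have nab: "{a,b} \<notin> E"
    proof
      assume E: "{a,b} \<in> E"
      then have "is_cycle V E [a,x,b]" using ab x(1) by (auto simp: is_cycle_iff cycle_edges_def insert_commute)
      from cyc[OF this] show False
        using axb edge[OF E ab(3)] p by (simp add: cycle_edges_def insert_commute)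
    qed
    define F where "F = insert {a,b} {e \<in> E. x \<notin> e}"
    define u where "u = w({a,b} := w {a,x} + w {x,b})"
    have F: "graph (V - {x}) F" "subdivide F a x b = E"
      using graph_suppress[OF G ab(6) ab(3,4,5) nab] unfolding F_def by auto
    \<comment> \<open>The present graph is the subdivided one, so its weight \<open>w\<close> takes
      the place of \<open>w'\<close> in the locale, and \<open>u\<close> that of
      \<open>w\<close>.\<close>
    interpret S: subdivided "V - {x}" F a x b u w
    proof
      show "w {a,x} + w {x,b} = u {a,b}" by (simp add: u_def)
      show "w e = u e" if "e \<noteq> {a,b}" for e using that by (simp add: u_def)
    qed (use F ab in \<open>auto simp: F_def\<close>)
    have V: "insert x (V - {x}) = V" using x(1) by blast
    \<comment> \<open>The suppressed graph inherits all hypotheses and is therefore empty, although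
      it contains \<open>a\<close>.\<close>
    have "V - {x} = {}"
    proof (rule less.hyps[OF _ F(1) _ p])
      show "card (V - {x}) < card V" using x(1) G by (intro card_Diff1_less) (auto simp: graph_def)
      show "planar (V - {x}) F"
        using planar_of_subdivide[OF F(1) _ S.ab S.x] pl unfolding V F(2) by blast
      show "2 \<le> degree F v" if "v \<in> V - {x}" for v
        using S.degree_old[OF that] deg[of v] that unfolding F(2) by simp
      show "5 * p \<le> weight u (cycle_edges cs) + 4" if "is_cycle (V - {x}) F cs" for cs
        using S.cycle_lift[OF that] cyc unfolding V F(2) by metis
      show "weight u (path_edges xs) < p"
        if "is_path (V - {x}) F xs" "2 \<le> length xs" "\<forall>v\<in>internal_vertices xs. degree F v = 2" for xs
        using S.path_lift[OF that] ear unfolding V F(2) by metis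
    qed
    then show False using ab(4) by blast
  qed
qed

section \<open>Path degeneracy\<close>

lemma weight_one: "(\<And>e. e \<in> set es \<Longrightarrow> w e = 1) \<Longrightarrow> weight w es = length es"
  by (induction es) auto

text \<open>For p = 1 an ear may be a single edge without internal vertices, and its reduction would
  delete nothing; \<open>p \<ge> 2\<close> ensures progress.\<close>

lemma p_reduction_smaller:
  assumes "p_reduction p V E V' E'" "p \<ge> 2"
  shows "V' \<subset> V" "E' = {e \<in> E. e \<inter> (V - V') = {}}"
proof -
  consider v where "v \<in> V" "(V', E') = del_verts V E {v}"
    | xs where "strict_ear V E xs" "length xs - 1 \<ge> p" "(V', E') = del_verts V E (internal_vertices xs)"
    using assms(1) unfolding p_reduction_def by blast
  then have "\<exists>S. S \<subseteq> V \<and> S \<noteq> {} \<and> (V', E') = del_verts V E S"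
  proof cases
    case 1 then show ?thesis by (intro exI[of _ "{v}"]) simp
  next
    case 2
    then have "is_path V E xs" by (simp add: strict_ear_def)
    then have "set xs \<subseteq> V" by (simp add: is_path_iff)
    moreover have "set (butlast (tl xs)) \<subseteq> set xs"
      using in_set_butlastD[of _ "tl xs"] by (cases xs) auto
    moreover have "length (butlast (tl xs)) > 0" using 2(2) assms(2) by simp
    then have "internal_vertices xs \<noteq> {}"
      unfolding internal_vertices_def by (metis length_greater_0_conv set_empty)
    ultimately show ?thesis using 2(3) unfolding internal_vertices_def by blast
  qed
  then obtain S where S: "S \<subseteq> V" "S \<noteq> {}" "V' = V - S" "E' = {e \<in> E. e \<inter> S = {}}"
    by (auto simp: del_verts_def)
  moreover have "V - V' = S" using S by blast
  ultimately show "V' \<subset> V" "E' = {e \<in> E. e \<inter> (V - V') = {}}" by auto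
qed

lemma girth_ge_iff: "enat g \<le> girth V E \<longleftrightarrow> (\<forall>cs. is_cycle V E cs \<longrightarrow> g \<le> length cs)"
  by (auto simp: girth_def le_INF_iff)

text \<open>A reduction leads to a smaller subgraph, which inherits planarity and the girth bound.
  If there is none, \<open>planar_weighted_reducible\<close> with all weights 1 shows that the graph
  is empty.\<close>

lemma planar_girth_path_degenerate:
  fixes V :: "'a set"
  assumes "p \<ge> 2" "graph V E" "planar V E" "girth V E \<ge> enat (5 * p - 4)"
  shows "path_degenerate p V E"
  using assms(2-4)
proof (induction "card V" arbitrary: V E rule: less_induct)
  case less
  note G = less.prems(1) and pl = less.prems(2)
  have cyc: "5 * p - 4 \<le> length cs" if "is_cycle V E cs" for cs
    using less.prems(3) that unfolding girth_ge_iff by blast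
  show ?case
  proof (cases "\<exists>V' E'. p_reduction p V E V' E'")
    case True
    then obtain V' E' where red: "p_reduction p V E V' E'" by blast
    have sm: "V' \<subset> V" "E' = {e \<in> E. e \<inter> (V - V') = {}}"
      using p_reduction_smaller[OF red assms(1)] by auto
    have EV: "e \<subseteq> V" if "e \<in> E" for e using G that by (simp add: graph_def)
    have sub: "V' \<subseteq> V" "E' \<subseteq> E" "\<Union>E' \<subseteq> V'" using sm EV by blast+
    have "path_degenerate p V' E'"
    proof (rule less.hyps)
      show "card V' < card V" using sm(1) G by (intro psubset_card_mono) (auto simp: graph_def)
      show "graph V' E'" by (rule graph_subgraph[OF G sub])
      show "planar V' E'" by (rule planar_subgraph[OF G pl sub])
      show "enat (5 * p - 4) \<le> girth V' E'"
        unfolding girth_ge_iff using cyc is_cycle_mono[OF _ sub(1,2)] by blast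
    qed
    then show ?thesis using red path_degenerate.step by blast
  next
    case False
    have deg: "degree E v \<ge> 2" if "v \<in> V" for v
    proof (rule ccontr)
      assume "\<not> ?thesis"
      then have "degree E v = 0 \<or> degree E v = 1" by linarith
      then have "p_reduction p V E (V - {v}) {e \<in> E. e \<inter> {v} = {}}"
        using that unfolding p_reduction_def del_verts_def by blast
      then show False using False by blast
    qed
    have ear: "length xs - 1 < p" if "is_path V E xs" "length xs \<ge> 2"
      "\<forall>v\<in>internal_vertices xs. degree E v = 2" for xs
    proof (rule ccontr)
      assume "\<not> ?thesis"
      moreover have "hd xs \<noteq> last xs"
        using that(1,2) by (cases xs) (auto simp: is_path_iff)
      ultimately have "p_reduction p V E (V - internal_vertices xs) {e \<in> E. e \<inter> internal_vertices xs = {}}"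
        using that unfolding p_reduction_def del_verts_def strict_ear_def not_less by blast
      then show False using False by blast
    qed
    have "V = {}"
    proof (rule planar_weighted_reducible[OF G pl _ deg, where w = "\<lambda>_. 1"])
      show "1 \<le> p" using assms(1) by simp
      show "5 * p \<le> weight (\<lambda>_. 1) (cycle_edges cs) + 4" if "is_cycle V E cs" for cs
        using cyc[OF that] by (simp add: weight_one length_cycle_edges)
      show "weight (\<lambda>_. 1) (path_edges xs) < p" if "is_path V E xs" "2 \<le> length xs"
        "\<forall>v\<in>internal_vertices xs. degree E v = 2" for xs
        using ear[OF that] by (simp add: weight_one length_path_edges)
    qed
    then show ?thesis by (simp add: path_degenerate.empty)
  qed
qed

text \<open>The labelling \<open>\<kappa>\<close> names, for each edge of a subdivision, the original edge it lies on.
  It is constant along an ear, so that \<open>q\<close> bounds the weight of every ear.\<close>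
definition rigid :: "nat \<Rightarrow> nat \<Rightarrow> 'a set \<Rightarrow> 'a set set \<Rightarrow> ('a set \<Rightarrow> nat) \<Rightarrow> ('a set \<Rightarrow> 'k) \<Rightarrow> bool" where
  "rigid g q V E w \<kappa> \<longleftrightarrow> graph V E \<and> planar V E \<and> (\<forall>v\<in>V. degree E v \<ge> 2) \<and>
     (\<forall>cs. is_cycle V E cs \<longrightarrow> g \<le> weight w (cycle_edges cs)) \<and>
     (\<exists>cs. is_cycle V E cs \<and> weight w (cycle_edges cs) = g) \<and>
     (\<forall>v e e'. degree E v = 2 \<longrightarrow> e \<in> E \<longrightarrow> v \<in> e \<longrightarrow> e' \<in> E \<longrightarrow> v \<in> e' \<longrightarrow> \<kappa> e = \<kappa> e') \<and>
     (\<forall>i. (\<Sum>e\<in>E. if \<kappa> e = i then w e else 0) \<le> q)"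

text \<open>Both halves of the edge keep its label, so the new vertex of degree 2 sees one label
  only and every label class keeps its total weight.\<close>

lemma rigid_subdivide:
  fixes V :: "'a set"
  assumes r: "rigid g q V E w \<kappa>" and ab: "{a,b} \<in> E" "a \<noteq> b" and x: "x \<notin> V"
    and n: "w {a,b} = m + n"
  shows "rigid g q (insert x V) (subdivide E a x b) (w({a,x} := m, {x,b} := n))
    (\<kappa>({a,x} := \<kappa> {a,b}, {x,b} := \<kappa> {a,b}))"
proof -
  let ?w = "w({a,x} := m, {x,b} := n)" and ?\<kappa> = "\<kappa>({a,x} := \<kappa> {a,b}, {x,b} := \<kappa> {a,b})"
  have r: "graph V E" "planar V E" "\<And>v. v \<in> V \<Longrightarrow> degree E v \<ge> 2"
    "\<And>cs. is_cycle V E cs \<Longrightarrow> g \<le> weight w (cycle_edges cs)"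
    "\<exists>cs. is_cycle V E cs \<and> weight w (cycle_edges cs) = g"
    "\<And>v e e'. degree E v = 2 \<Longrightarrow> e \<in> E \<Longrightarrow> v \<in> e \<Longrightarrow> e' \<in> E \<Longrightarrow> v \<in> e' \<Longrightarrow> \<kappa> e = \<kappa> e'"
    "\<And>i. (\<Sum>e\<in>E. if \<kappa> e = i then w e else 0) \<le> q"
    using r unfolding rigid_def by blast+
  have xE: "x \<notin> e" if "e \<in> E" for e using r(1) x that by (auto simp: graph_def)
  have abx: "{a,x} \<noteq> {x,b}" "a \<noteq> x" "b \<noteq> x"
    using xE[OF ab(1)] ab(2) by (auto simp: doubleton_eq_iff)
  have old: "?w e = w e" "?\<kappa> e = \<kappa> e" if "e \<in> E" for e using xE[OF that] by auto
  have new: "?w {a,x} = m" "?w {x,b} = n" "?\<kappa> {a,x} = \<kappa> {a,b}" "?\<kappa> {x,b} = \<kappa> {a,b}"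
    using abx by auto
  interpret S: subdivided V E a x b w ?w
    by unfold_locales (use r(1) ab x old new n in auto)
  have lbl: "?\<kappa> e = ?\<kappa> e'"
    if v: "degree S.E' v = 2" "e \<in> S.E'" "v \<in> e" "e' \<in> S.E'" "v \<in> e'" for v e e'
  proof (cases "v = x")
    case True
    then have "e \<in> {{a,x},{x,b}}" "e' \<in> {{a,x},{x,b}}" using S.edges_at_x v by blast+
    then show ?thesis using new by auto
  next
    case False
    have "\<exists>d\<in>E. v \<in> d \<and> ?\<kappa> e = \<kappa> d" if "e \<in> S.E'" "v \<in> e" for e
    proof (cases "x \<in> e")
      case True
      then have "e = {a,x} \<or> e = {x,b}" using S.edges_at_x that by blast
      then show ?thesis using new ab(1) that(2) False by (intro bexI[of _ "{a,b}"]) auto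
    next
      case F: False
      then show ?thesis using S.E'_old[OF that(1)] old(2) that(2) by blast
    qed
    then obtain d d' where d: "d \<in> E" "v \<in> d" "?\<kappa> e = \<kappa> d" "d' \<in> E" "v \<in> d'" "?\<kappa> e' = \<kappa> d'"
      using v by meson
    have "v \<in> V" using S.edge_subset d by blast
    then have "degree E v = 2" using S.degree_old v(1) by simp
    then show ?thesis using r(6) d by metis
  qed
  have cls: "(\<Sum>e\<in>S.E'. if ?\<kappa> e = i then ?w e else 0) \<le> q" for i
  proof -
    let ?h' = "\<lambda>e. if ?\<kappa> e = i then ?w e else 0" and ?h = "\<lambda>e. if \<kappa> e = i then w e else 0"
    have "(\<Sum>e\<in>S.E'. ?h' e) + ?h {a,b} = (\<Sum>e\<in>E. ?h e) + ?h' {a,x} + ?h' {x,b}"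
      by (rule S.sum_subdivide) (simp only: old)
    moreover have "?h {a,b} = ?h' {a,x} + ?h' {x,b}" by (simp only: new n split: if_split) simp
    ultimately have "(\<Sum>e\<in>S.E'. ?h' e) = (\<Sum>e\<in>E. ?h e)" by linarith
    then show ?thesis using r(7)[of i] by linarith
  qed
  have deg: "degree S.E' v \<ge> 2" if "v \<in> S.V'" for v
    using that S.degree_x S.degree_old[of v] r(3)[of v] by (cases "v = x") auto
  have cyc: "g \<le> weight ?w (cycle_edges cs)" if "is_cycle S.V' S.E' cs" for cs
    using S.cycle_project[OF that] r(4) by metis
  have ex: "\<exists>cs. is_cycle S.V' S.E' cs \<and> weight ?w (cycle_edges cs) = g"
    using r(5) S.cycle_lift by metis
  show ?thesis
    unfolding rigid_def
  proof (intro conjI allI impI ballI)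
    show "graph S.V' S.E'" by (rule graph_subdivide[OF r(1) ab x])
    show "planar S.V' S.E'" by (rule planar_subdivide[OF r(1,2) ab x])
  qed (fact deg cyc ex lbl cls)+
qed

text \<open>Each step splits off an edge of weight 1 from an edge that is too heavy, which lowers
  the total excess over weight 1 by one. Vertices are naturals so that a fresh one is always
  available.\<close>

lemma rigid_subdivide_all:
  fixes V :: "nat set" and \<kappa> :: "nat set \<Rightarrow> 'k"
  assumes "rigid g q V E w \<kappa>" "\<And>e. e \<in> E \<Longrightarrow> w e \<ge> 1"
  shows "\<exists>(V' :: nat set) E' w' (\<kappa>' :: nat set \<Rightarrow> 'k). rigid g q V' E' w' \<kappa>' \<and> (\<forall>e\<in>E'. w' e = 1)"
  using assms
proof (induction "\<Sum>e\<in>E. w e - 1" arbitrary: V E w \<kappa> rule: less_induct)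
  case less
  have G: "graph V E" using less.prems(1) by (simp add: rigid_def)
  show ?case
  proof (cases "\<forall>e\<in>E. w e = 1")
    case True
    then show ?thesis using less.prems(1) by blast
  next
    case False
    then obtain e where e: "e \<in> E" "w e \<noteq> 1" by blast
    have "card e = 2" using G e(1) by (simp add: graph_def)
    then obtain a b where ab: "e = {a,b}" "a \<noteq> b" unfolding card_2_iff by blast
    have E: "{a,b} \<in> E" using e(1) unfolding ab(1) .
    have w2: "w {a,b} \<ge> 2" using less.prems(2)[OF e(1)] e(2) unfolding ab(1) by linarith
    have "finite V" using G by (simp add: graph_def)
    then obtain x where x: "x \<notin> V" using ex_new_if_finite infinite_UNIV_nat by blast
    let ?w = "w({a,x} := 1, {x,b} := w {a,b} - 1)"
      and ?\<kappa> = "\<kappa>({a,x} := \<kappa> {a,b}, {x,b} := \<kappa> {a,b})"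
    have rig: "rigid g q (insert x V) (subdivide E a x b) ?w ?\<kappa>"
      by (rule rigid_subdivide[OF less.prems(1) E ab(2) x]) (use w2 in simp)
    have xE: "x \<notin> e" if "e \<in> E" for e using G x that by (auto simp: graph_def)
    have abx: "{a,x} \<noteq> {x,b}" using xE[OF E] ab(2) by (auto simp: doubleton_eq_iff)
    have old: "?w e = w e" if "e \<in> E" for e using xE[OF that] by auto
    have new: "?w {a,x} = 1" "?w {x,b} = w {a,b} - 1" using abx by auto
    interpret S: subdivided V E a x b w ?w
    proof
      show "?w {a,x} + ?w {x,b} = w {a,b}" unfolding new using w2 by simp
      show "?w e = w e" if "e \<in> E" for e using old[OF that] .
    qed (fact G E ab(2) x)+
    have "(\<Sum>e\<in>S.E'. ?w e - 1) + (w {a,b} - 1) = (\<Sum>e\<in>E. w e - 1) + (?w {a,x} - 1) + (?w {x,b} - 1)"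
      by (rule S.sum_subdivide[of "\<lambda>e. ?w e - 1" "\<lambda>e. w e - 1"]) (use old in simp)
    then have lt: "(\<Sum>e\<in>S.E'. ?w e - 1) < (\<Sum>e\<in>E. w e - 1)"
      unfolding new using w2 by linarith
    have ge: "?w e \<ge> 1" if "e \<in> S.E'" for e
    proof (cases "x \<in> e")
      case True
      then have "e = {a,x} \<or> e = {x,b}" using S.edges_at_x that by blast
      then show ?thesis using new w2 by (elim disjE) simp_all
    next
      case F: False
      then have "e \<in> E" using S.E'_old[OF that] by blast
      then show ?thesis using old[of e] less.prems(2)[of e] by simp
    qed
    show ?thesis by (rule less.hyps[OF lt rig ge])
  qed
qed

text \<open>The edges of an ear form part of one label class, so with unit weights there are at most
  \<open>q\<close> of them. As there are no vertices of degree below 2 either, no reduction at all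
  applies to this nonempty graph.\<close>

lemma rigid_not_path_degenerate:
  assumes r: "rigid g q V E w \<kappa>" and one: "\<And>e. e \<in> E \<Longrightarrow> w e = 1" and q: "q < p"
  shows "\<not> path_degenerate p V E" "girth V E = enat g"
proof -
  have r: "graph V E" "\<And>v. v \<in> V \<Longrightarrow> degree E v \<ge> 2"
    "\<And>cs. is_cycle V E cs \<Longrightarrow> g \<le> weight w (cycle_edges cs)"
    "\<exists>cs. is_cycle V E cs \<and> weight w (cycle_edges cs) = g"
    "\<And>v e e'. degree E v = 2 \<Longrightarrow> e \<in> E \<Longrightarrow> v \<in> e \<Longrightarrow> e' \<in> E \<Longrightarrow> v \<in> e' \<Longrightarrow> \<kappa> e = \<kappa> e'"
    "\<And>i. (\<Sum>e\<in>E. if \<kappa> e = i then w e else 0) \<le> q"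
    using r unfolding rigid_def by blast+
  have len: "weight w (cycle_edges cs) = length cs" if "is_cycle V E cs" for cs
  proof -
    have "set (cycle_edges cs) \<subseteq> E" using that by (simp add: is_cycle_iff)
    then show ?thesis using one weight_one[of "cycle_edges cs" w] by (simp add: subset_iff length_cycle_edges)
  qed
  obtain cs where cs: "is_cycle V E cs" "weight w (cycle_edges cs) = g" using r(4) by (elim exE conjE)
  have "girth V E \<le> enat (length cs)" unfolding girth_def using cs(1) by (intro INF_lower) simp
  moreover have "enat g \<le> girth V E" unfolding girth_ge_iff using r(3) len by simp
  ultimately show "girth V E = enat g" using cs(2) len[OF cs(1)] by simp
  have "V \<noteq> {}" using cs(1) by (auto simp: is_cycle_iff)
  have fin: "finite E" by (rule graph_finite_edges[OF r(1)])
  have no_ear: "length xs - 1 < p" if xs: "strict_ear V E xs" for xs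
  proof (cases "length xs \<ge> 2")
    case True
    have d: "distinct xs" "set (path_edges xs) \<subseteq> E" and deg: "\<forall>v\<in>internal_vertices xs. degree E v = 2"
      using xs by (auto simp: strict_ear_def is_path_iff)
    \<comment> \<open>Consecutive edges share an internal vertex, which has degree 2 and so forces
      equal labels.\<close>
    have "\<exists>i. \<forall>e\<in>set (path_edges ys). \<kappa> e = i"
      if "set (path_edges ys) \<subseteq> E" "\<forall>v\<in>set (butlast (tl ys)). degree E v = 2" for ys
      using that
    proof (induction ys rule: path_edges.induct)
      case (1 y z zs)
      show ?case
      proof (cases zs)
        case Nil then show ?thesis by simp
      next
        case (Cons u us)
        obtain i where i: "\<forall>e\<in>set (path_edges (z # zs)). \<kappa> e = i"
        proof -
          have "set (path_edges (z # zs)) \<subseteq> E" using 1(2) by simp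
          moreover have "\<forall>v\<in>set (butlast (tl (z # zs))). degree E v = 2" using 1(3) by (simp add: Cons)
          ultimately show ?thesis using 1(1) that by blast
        qed
        have "degree E z = 2" using 1(3) by (simp add: Cons)
        then have "\<kappa> {y,z} = \<kappa> {z,u}"
          by (rule r(5)) (use 1(2) in \<open>simp_all add: Cons\<close>)
        also have "\<dots> = i" using i by (simp add: Cons)
        finally show ?thesis using i by auto
      qed
    qed auto
    then obtain i where i: "\<forall>e\<in>set (path_edges xs). \<kappa> e = i"
      using d(2) deg unfolding internal_vertices_def by metis
    have "length xs - 1 = card (set (path_edges xs))"
      using distinct_path_edges[OF d(1)] by (simp add: distinct_card length_path_edges)
    also have "\<dots> = (\<Sum>e\<in>set (path_edges xs). if \<kappa> e = i then w e else 0)"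
      using i one d(2) by (simp add: subset_iff)
    also have "\<dots> \<le> (\<Sum>e\<in>E. if \<kappa> e = i then w e else 0)"
      using fin d(2) by (intro sum_mono2) auto
    also have "\<dots> \<le> q" by (rule r(6))
    finally show ?thesis using q by simp
  qed (use q in simp)
  have no: "\<not> p_reduction p V E V' E'" for V' E'
  proof
    assume "p_reduction p V E V' E'"
    then consider v where "v \<in> V" "degree E v = 0 \<or> degree E v = 1"
      | xs where "strict_ear V E xs" "length xs - 1 \<ge> p" unfolding p_reduction_def by blast
    then show False
    proof cases
      case 1 then show ?thesis using r(2)[of v] by linarith
    next
      case 2 then show ?thesis using no_ear[of xs] by linarith
    qed
  qed
  show "\<not> path_degenerate p V E"
  proof
    assume "path_degenerate p V E"
    then show False
    proof cases
      case empty then show ?thesis using \<open>V \<noteq> {}\<close> by simp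
    next
      case (step V' E') then show ?thesis using no by blast
    qed
  qed
qed

section \<open>The dodecahedron\<close>

text \<open>The outer pentagon is 0 to 4 and the inner one 15 to 19. Between them runs a cycle of
  length ten that alternates between 5 to 9, joined to the outer pentagon, and 10 to 14, joined to
  the inner one. The smaller end comes first, so that \<open>Min\<close> and \<open>Max\<close>
  recover the pair from the edge.\<close>

definition dod_arcs :: "(nat \<times> nat) list" where
  "dod_arcs = [(0,1),(1,2),(2,3),(3,4),(0,4),(0,5),(1,6),(2,7),(3,8),(4,9),
     (5,10),(6,10),(6,11),(7,11),(7,12),(8,12),(8,13),(9,13),(9,14),(5,14),
     (10,15),(11,16),(12,17),(13,18),(14,19),(15,16),(16,17),(17,18),(18,19),(15,19)]"

text \<open>A straight-line drawing; the innermost pentagon is twisted so that no two disjoint edges lie on a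
  common line.\<close>
definition dod_pos :: "nat \<Rightarrow> int \<times> int" where
  "dod_pos v = [(9,0),(3,9),(-7,5),(-7,-5),(3,-9),(5,0),(2,5),(-4,3),(-4,-3),(2,-5),
     (4,3),(-2,5),(-5,0),(-2,-5),(4,-3),(1,2),(-1,2),(-2,-1),(0,-2),(2,-1)] ! v"

text \<open>Twice the signed area of the triangle: its sign tells on which side of the line from
  \<open>u\<close> to \<open>v\<close> the vertex \<open>w\<close> lies. Integer coordinates allow
  evaluation.\<close>

definition cross :: "nat \<Rightarrow> nat \<Rightarrow> nat \<Rightarrow> int" where
  "cross u v w = (case (dod_pos u, dod_pos v, dod_pos w) of ((a,b),(c,d),(x,y)) \<Rightarrow>
     (c - a) * (y - b) - (d - b) * (x - a))"

definition strictly_beside :: "nat \<Rightarrow> nat \<Rightarrow> nat \<Rightarrow> nat \<Rightarrow> bool" where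
  "strictly_beside u v s t \<longleftrightarrow> cross u v s > 0 \<and> cross u v t > 0 \<or> cross u v s < 0 \<and> cross u v t < 0"

text \<open>Of two disjoint segments that are not on a common line, one avoids the line through the other.\<close>
definition compatible :: "nat \<times> nat \<Rightarrow> nat \<times> nat \<Rightarrow> bool" where
  "compatible = (\<lambda>(u,v) (s,t).
     if u = s then v = t \<or> cross u v t \<noteq> 0
     else if u = t then cross u v s \<noteq> 0
     else if v = s then cross v u t \<noteq> 0
     else if v = t then cross v u s \<noteq> 0
     else strictly_beside u v s t \<or> strictly_beside s t u v)"

lemma dod_compatible: "list_all (\<lambda>e. list_all (compatible e) dod_arcs) dod_arcs"
  by code_simp

lemma dod_arcs_range: "list_all (\<lambda>(u,v). u < v \<and> v < 20) dod_arcs"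
  by code_simp

definition dod_nbrs :: "nat \<Rightarrow> nat list" where
  "dod_nbrs v = map snd (filter (\<lambda>e. fst e = v) dod_arcs) @ map fst (filter (\<lambda>e. snd e = v) dod_arcs)"

definition dod_pt :: "nat \<Rightarrow> complex" where
  "dod_pt v = Complex (of_int (fst (dod_pos v))) (of_int (snd (dod_pos v)))"

definition dod_edges :: "nat set set" where
  "dod_edges = (\<lambda>(u,v). {u,v}) ` set dod_arcs"

text \<open>The extension of \<open>cross\<close> to arbitrary points. It is affine in
  \<open>z\<close>, so on a segment it interpolates between its values at the ends.\<close>

definition side_fun :: "nat \<Rightarrow> nat \<Rightarrow> complex \<Rightarrow> real" where
  "side_fun u v z = (Re (dod_pt v) - Re (dod_pt u)) * (Im z - Im (dod_pt u))
     - (Im (dod_pt v) - Im (dod_pt u)) * (Re z - Re (dod_pt u))"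

lemma side_fun_pt: "side_fun u v (dod_pt w) = of_int (cross u v w)"
  by (simp add: side_fun_def cross_def dod_pt_def split_beta)

lemma side_fun_segment:
  "side_fun u v ((1 - r) *\<^sub>R y + r *\<^sub>R z) = (1 - r) * side_fun u v y + r * side_fun u v z"
  by (simp add: side_fun_def algebra_simps)

lemma cross_ends: "cross u v u = 0" "cross u v v = 0"
  by (simp_all add: cross_def split_beta)

lemma side_fun_on_segment:
  assumes "z \<in> closed_segment (dod_pt u) (dod_pt v)"
  shows "side_fun u v z = 0"
proof -
  obtain r where "z = (1 - r) *\<^sub>R dod_pt u + r *\<^sub>R dod_pt v"
    using assms by (auto simp: closed_segment_def)
  then show ?thesis by (simp add: side_fun_segment side_fun_pt cross_ends)
qed

text \<open>\<open>side_fun u v\<close> vanishes on the first segment, but has one strict sign at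
  both ends of the second and hence all along it.\<close>

lemma strictly_beside_disjoint:
  assumes "strictly_beside u v s t"
  shows "closed_segment (dod_pt u) (dod_pt v) \<inter> closed_segment (dod_pt s) (dod_pt t) = {}"
proof (rule ccontr)
  assume "\<not> ?thesis"
  then obtain z where z: "z \<in> closed_segment (dod_pt u) (dod_pt v)" "z \<in> closed_segment (dod_pt s) (dod_pt t)"
    by blast
  obtain r where r: "0 \<le> r" "r \<le> 1" "z = (1 - r) *\<^sub>R dod_pt s + r *\<^sub>R dod_pt t"
    using z(2) by (auto simp: closed_segment_def)
  have 0: "(1 - r) * of_int (cross u v s) + r * of_int (cross u v t) = 0"
    using side_fun_on_segment[OF z(1)] unfolding r(3) side_fun_segment side_fun_pt .
  consider "cross u v s > 0" "cross u v t > 0" | "cross u v s < 0" "cross u v t < 0"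
    using assms unfolding strictly_beside_def by blast
  then show False
  proof cases
    case 1
    then have "(1 - r) * of_int (cross u v s) \<ge> 0" "r * of_int (cross u v t) \<ge> 0" using r by simp_all
    then have "(1 - r) * of_int (cross u v s) = 0" "r * of_int (cross u v t) = 0" using 0 by linarith+
    then show ?thesis using 1 by simp
  next
    case 2
    then have "(1 - r) * of_int (cross u v s) \<le> 0" "r * of_int (cross u v t) \<le> 0"
      using r by (simp_all add: mult_nonneg_nonpos)
    then have "(1 - r) * of_int (cross u v s) = 0" "r * of_int (cross u v t) = 0" using 0 by linarith+
    then show ?thesis using 2 by simp
  qed
qed

text \<open>Along the second segment \<open>side_fun u v\<close> is a nonzero multiple of the
  parameter, so it vanishes only at the common end.\<close>

lemma cross_nonzero_meet:
  assumes "cross u v t \<noteq> 0"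
  shows "closed_segment (dod_pt u) (dod_pt v) \<inter> closed_segment (dod_pt u) (dod_pt t) \<subseteq> {dod_pt u}"
proof
  fix z assume "z \<in> closed_segment (dod_pt u) (dod_pt v) \<inter> closed_segment (dod_pt u) (dod_pt t)"
  then have z: "z \<in> closed_segment (dod_pt u) (dod_pt v)" "z \<in> closed_segment (dod_pt u) (dod_pt t)" by auto
  obtain r where r: "z = (1 - r) *\<^sub>R dod_pt u + r *\<^sub>R dod_pt t"
    using z(2) by (auto simp: closed_segment_def)
  have "(1 - r) * of_int (cross u v u) + r * of_int (cross u v t) = 0"
    using side_fun_on_segment[OF z(1)] unfolding r side_fun_segment side_fun_pt .
  then have "r = 0" using assms by (simp add: cross_ends)
  then show "z \<in> {dod_pt u}" by (simp add: r)
qed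

lemma compatible_meet:
  assumes "compatible (u,v) (s,t)" "(u,v) \<noteq> (s,t)" "u < v" "s < t"
  shows "closed_segment (dod_pt u) (dod_pt v) \<inter> closed_segment (dod_pt s) (dod_pt t) \<subseteq>
    dod_pt ` ({u,v} \<inter> {s,t})"
proof -
  note c = assms(1)[unfolded compatible_def split]
  consider "u = s" "v \<noteq> t" | "u \<noteq> s" "u = t" | "u \<noteq> s" "u \<noteq> t" "v = s" | "u \<noteq> s" "u \<noteq> t" "v \<noteq> s" "v = t"
    | "u \<noteq> s" "u \<noteq> t" "v \<noteq> s" "v \<noteq> t" using assms(2) by auto
  then show ?thesis
  proof cases
    case 1 then show ?thesis using c cross_nonzero_meet[of u v t] by auto
  next
    case 2 then show ?thesis using c cross_nonzero_meet[of u v s] by (auto simp: closed_segment_commute)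
  next
    case 3 then show ?thesis using c cross_nonzero_meet[of v u t] by (auto simp: closed_segment_commute)
  next
    case 4 then show ?thesis using c cross_nonzero_meet[of v u s] by (auto simp: closed_segment_commute)
  next
    case 5
    then have "strictly_beside u v s t \<or> strictly_beside s t u v" using c by simp
    then show ?thesis using strictly_beside_disjoint[of u v s t] strictly_beside_disjoint[of s t u v] by blast
  qed
qed

section \<open>Degrees, girth and planarity of the dodecahedron\<close>

lemma dod_arc: "(u,v) \<in> set dod_arcs \<Longrightarrow> u < v \<and> v < 20"
  using dod_arcs_range by (auto simp: list_all_iff)

lemma dod_pos_inj: "inj_on dod_pos {..<20}"
proof -
  have "distinct (map dod_pos [0..<20])" by code_simp
  then show ?thesis by (simp add: distinct_map atLeast_upt)
qed

lemma dod_pt_inj: "inj_on dod_pt {..<20}"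
  using dod_pos_inj unfolding inj_on_def dod_pt_def by (simp add: prod_eq_iff)

lemma dod_edgeE:
  assumes "e \<in> dod_edges"
  obtains u v where "e = {u,v}" "(u,v) \<in> set dod_arcs" "u < v" "v < 20" "Min e = u" "Max e = v"
proof -
  obtain u v where uv: "e = {u,v}" "(u,v) \<in> set dod_arcs" using assms by (auto simp: dod_edges_def)
  have lt: "u < v" "v < 20" using dod_arc[OF uv(2)] by auto
  then have "Min e = u" "Max e = v" unfolding uv(1) by simp_all
  then show thesis using that uv lt by blast
qed

lemma dod_graph: "graph {..<20} dod_edges"
  unfolding graph_def by (auto elim!: dod_edgeE)

lemma dod_nbrs: "v \<in> set (dod_nbrs u) \<longleftrightarrow> {u,v} \<in> dod_edges"
  by (force simp: dod_nbrs_def dod_edges_def doubleton_eq_iff)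

text \<open>Besides 3-regularity this follows all walks u, v, w, t without immediate return: that
  \<open>u\<close> is not adjacent to \<open>w\<close> excludes triangles, and that it is not
  adjacent to \<open>t\<close> excludes 4-cycles.\<close>

lemma dod_nbrs_checks:
  "list_all (\<lambda>u. length (dod_nbrs u) = 3 \<and> distinct (dod_nbrs u) \<and>
     list_all (\<lambda>v. list_all (\<lambda>w. w = u \<or> u \<notin> set (dod_nbrs w) \<and>
       list_all (\<lambda>t. t = v \<or> u \<notin> set (dod_nbrs t)) (dod_nbrs w)) (dod_nbrs v)) (dod_nbrs u)) [0..<20]"
  by code_simp

lemma dod_degree:
  assumes "v < 20" shows "degree dod_edges v = 3"
proof -
  have d: "length (dod_nbrs v) = 3" "distinct (dod_nbrs v)"
    using dod_nbrs_checks assms by (auto simp: list_all_iff)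
  have "{e \<in> dod_edges. v \<in> e} = (\<lambda>w. {v,w}) ` set (dod_nbrs v)"
  proof (intro subset_antisym subsetI)
    fix e assume "e \<in> {e \<in> dod_edges. v \<in> e}"
    then have e: "e \<in> dod_edges" "v \<in> e" by auto
    obtain w where w: "e = {v,w}" using graph_edge[OF dod_graph e] by blast
    then have "w \<in> set (dod_nbrs v)" using e(1) unfolding dod_nbrs by simp
    then show "e \<in> (\<lambda>w. {v,w}) ` set (dod_nbrs v)" using w by blast
  next
    fix e assume "e \<in> (\<lambda>w. {v,w}) ` set (dod_nbrs v)"
    then show "e \<in> {e \<in> dod_edges. v \<in> e}" using dod_nbrs by blast
  qed
  moreover have "inj_on (\<lambda>w. {v,w}) (set (dod_nbrs v))" by (auto simp: inj_on_def doubleton_eq_iff)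
  ultimately show ?thesis unfolding degree_def using d by (simp add: card_image distinct_card)
qed

lemma dod_no_short_cycle:
  assumes "u < 20" "v \<in> set (dod_nbrs u)" "w \<in> set (dod_nbrs v)" "w \<noteq> u"
  shows "u \<notin> set (dod_nbrs w)" "t \<in> set (dod_nbrs w) \<Longrightarrow> t \<noteq> v \<Longrightarrow> u \<notin> set (dod_nbrs t)"
proof -
  have "u \<in> set [0..<20]" using assms(1) by simp
  then have "w = u \<or> u \<notin> set (dod_nbrs w) \<and> (\<forall>t\<in>set (dod_nbrs w). t = v \<or> u \<notin> set (dod_nbrs t))"
    using dod_nbrs_checks assms(2,3) unfolding list_all_iff by blast
  then show "u \<notin> set (dod_nbrs w)" "t \<in> set (dod_nbrs w) \<Longrightarrow> t \<noteq> v \<Longrightarrow> u \<notin> set (dod_nbrs t)"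
    using assms(4) by blast+
qed

lemma dod_cycle_length:
  assumes "is_cycle {..<20} dod_edges cs" shows "5 \<le> length cs"
proof (rule ccontr)
  assume "\<not> ?thesis"
  moreover have cs: "distinct cs" "length cs \<ge> 3" "set cs \<subseteq> {..<20}" "set (cycle_edges cs) \<subseteq> dod_edges"
    using assms by (auto simp: is_cycle_iff)
  ultimately have "length cs = 3 \<or> length cs = 4" by linarith
  then consider a b c where "cs = [a,b,c]" | a b c d where "cs = [a,b,c,d]"
    by (auto simp: length_Suc_conv numeral_eq_Suc)
  then show False
  proof cases
    case 1
    then have "b \<in> set (dod_nbrs a)" "c \<in> set (dod_nbrs b)" "a \<in> set (dod_nbrs c)" "a < 20" "c \<noteq> a"
      using cs by (auto simp: dod_nbrs cycle_edges_def)
    then show ?thesis using dod_no_short_cycle(1) by blast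
  next
    case 2
    then have "b \<in> set (dod_nbrs a)" "c \<in> set (dod_nbrs b)" "d \<in> set (dod_nbrs c)" "a \<in> set (dod_nbrs d)"
      "a < 20" "c \<noteq> a" "d \<noteq> b"
      using cs by (auto simp: dod_nbrs cycle_edges_def)
    then show ?thesis using dod_no_short_cycle(2) by blast
  qed
qed

lemma dod_outer_cycle: "is_cycle {..<20} dod_edges [0,1,2,3,4]"
  by (simp add: is_cycle_iff cycle_edges_def dod_edges_def dod_arcs_def insert_commute)

lemma dod_planar: "planar {..<20} dod_edges"
proof -
  let ?\<gamma> = "\<lambda>e. linepath (dod_pt (Min e)) (dod_pt (Max e))"
  have meet: "path_image (?\<gamma> e) \<inter> path_image (?\<gamma> e') \<subseteq> dod_pt ` (e \<inter> e')"
    if e: "e \<in> dod_edges" and e': "e' \<in> dod_edges" and ne: "e \<noteq> e'" for e e'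
  proof -
    obtain u v where uv: "e = {u,v}" "(u,v) \<in> set dod_arcs" "u < v" "v < 20" "Min e = u" "Max e = v"
      using dod_edgeE[OF e] .
    obtain s t where st: "e' = {s,t}" "(s,t) \<in> set dod_arcs" "s < t" "t < 20" "Min e' = s" "Max e' = t"
      using dod_edgeE[OF e'] .
    have c: "compatible (u,v) (s,t)" using dod_compatible uv(2) st(2) unfolding list_all_iff by blast
    have d: "(u,v) \<noteq> (s,t)" using ne uv(1) st(1) by auto
    show ?thesis
      using compatible_meet[OF c d uv(3) st(3)]
      unfolding uv(5,6) st(5,6) path_image_linepath unfolding uv(1) st(1) .
  qed
  have ends: "dod_pt ` e \<subseteq> path_image (?\<gamma> e)" if "e \<in> dod_edges" for e
    by (rule dod_edgeE[OF that]) auto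
  have "drawing {..<20} dod_edges dod_pt ?\<gamma>"
  proof
    show "inj_on dod_pt {..<20}" by (rule dod_pt_inj)
    fix e assume e: "e \<in> dod_edges"
    obtain u v where uv: "e = {u,v}" "(u,v) \<in> set dod_arcs" "u < v" "v < 20" "Min e = u" "Max e = v"
      using dod_edgeE[OF e] .
    show sub: "e \<subseteq> {..<20}" using uv(1,3,4) by auto
    show "arc (?\<gamma> e)"
      using inj_onD[OF dod_pt_inj, of u v] uv(3,4) unfolding uv(5,6) by (intro arc_linepath) auto
    show "\<exists>u v. e = {u, v} \<and> pathstart (?\<gamma> e) = dod_pt u \<and> pathfinish (?\<gamma> e) = dod_pt v"
      using uv(1) unfolding uv(5,6) by (intro exI[of _ u] exI[of _ v]) simp
    show "path_image (?\<gamma> e) \<inter> dod_pt ` {..<20} = dod_pt ` e"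
    proof
      show "dod_pt ` e \<subseteq> path_image (?\<gamma> e) \<inter> dod_pt ` {..<20}" using ends[OF e] sub by blast
      show "path_image (?\<gamma> e) \<inter> dod_pt ` {..<20} \<subseteq> dod_pt ` e"
      proof
        fix z assume "z \<in> path_image (?\<gamma> e) \<inter> dod_pt ` {..<20}"
        then obtain w where w: "w < 20" "z = dod_pt w" "z \<in> path_image (?\<gamma> e)" by blast
        \<comment> \<open>That an edge passes through no foreign vertex needs no check of its own:
          the vertex lies on a second edge, and the two edges meet only in images of common
          ends.\<close>
        have "\<exists>e'\<in>dod_edges. w \<in> e' \<and> e' \<noteq> e"
          using degree_ge_2_other_edge[of dod_edges w] dod_degree[OF w(1)] by simp
        then obtain e' where e': "e' \<in> dod_edges" "w \<in> e'" "e \<noteq> e'" by blast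
        have "z \<in> path_image (?\<gamma> e')" using ends[OF e'(1)] e'(2) w(2) by blast
        then show "z \<in> dod_pt ` e" using meet[OF e e'(1,3)] w(3) by blast
      qed
    qed
    fix e' assume "e' \<in> dod_edges" "e \<noteq> e'"
    then show "path_image (?\<gamma> e) \<inter> path_image (?\<gamma> e') \<subseteq> dod_pt ` (e \<inter> e')" by (rule meet[OF e])
  qed
  then show ?thesis by (rule drawing.planar)
qed

text \<open>Each edge is its own label, so every class has weight at most \<open>q\<close>, and the
  label condition is vacuous because no vertex has degree 2.\<close>

lemma dod_rigid: "rigid (5 * q) q {..<20} dod_edges (\<lambda>_. q) (\<lambda>e. e)"
proof -
  have w: "weight (\<lambda>_. q) (cycle_edges cs) = length cs * q" for cs :: "nat list"
    by (simp add: sum_list_triv length_cycle_edges)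
  have no2: "degree dod_edges v \<noteq> 2" for v
  proof (cases "v < 20")
    case False
    then have "{e \<in> dod_edges. v \<in> e} = {}" using dod_graph by (auto simp: graph_def)
    then show ?thesis by (simp only: degree_def) simp
  qed (simp add: dod_degree)
  have "finite dod_edges" by (rule graph_finite_edges[OF dod_graph])
  then show ?thesis
    unfolding rigid_def w using dod_graph dod_planar dod_degree no2 dod_cycle_length dod_outer_cycle
    by (auto intro!: exI[of _ "[0,1,2,3,4]"])
qed

theorem mainTheorem8:
  fixes p :: nat
  assumes "p \<ge> 2"
  shows "(\<forall>(V :: 'a set) E. graph V E \<and> planar V E \<and> girth V E \<ge> enat (5 * p - 4)
            \<longrightarrow> path_degenerate p V E) \<and>
         (\<exists>(V :: nat set) E. graph V E \<and> planar V E \<and> girth V E = enat (5 * p - 5) \<and>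
            \<not> path_degenerate p V E)"
proof
  show "\<forall>(V :: 'a set) E. graph V E \<and> planar V E \<and> girth V E \<ge> enat (5 * p - 4)
            \<longrightarrow> path_degenerate p V E"
    using planar_girth_path_degenerate[OF assms] by blast
  \<comment> \<open>The common weight p - 1 of the edges must be positive for the subdivision into
    edges of weight 1.\<close>
  have q: "1 \<le> p - 1" using assms by simp
  obtain V :: "nat set" and E w and \<kappa> :: "nat set \<Rightarrow> nat set"
    where r: "rigid (5 * (p - 1)) (p - 1) V E w \<kappa>" "\<forall>e\<in>E. w e = 1"
    using rigid_subdivide_all[OF dod_rigid[of "p - 1"] q] by blast
  have "graph V E" "planar V E" using r(1) by (simp_all add: rigid_def)
  moreover have "\<not> path_degenerate p V E" "girth V E = enat (5 * (p - 1))"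
    using rigid_not_path_degenerate[OF r(1), of p] r(2) assms by simp_all
  moreover have "5 * (p - 1) = 5 * p - 5" by simp
  ultimately show "\<exists>(V :: nat set) E. graph V E \<and> planar V E \<and> girth V E = enat (5 * p - 5) \<and>
            \<not> path_degenerate p V E" by metis
qed
end
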